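(* Let $G$ be a subdivided $\Pi$-graph and let $u,v$ be two distinct branch vertices of $G$. Then there exist subgraphs $H_u,H_v\subseteq G$ such that $X:=V(H_u)\cap V(H_v)$ is non-empty and: (i) $H_u[X]=H_v[X]$, and this induced subgraph is finite and connected; (ii) $u,v\notin X$; (iii) $H_u/X$ is a subdivided $\Pi$-graph in which $u$ and $X$ are branch vertices, and $H_v/X$ is a subdivided $\Pi$-graph in which $v$ and $X$ are branch vertices; (iv) $uX$ is an edge of $H_u/X$ and $vX$ is an edge of $H_v/X$.
   Context: Graphs are simple and may be infinite. A graph is infinitely edge-connected if it has at least two vertices and $G-E'$ is connected for every finite edge set $E'$. A $\Pi$-graph is an infinitely edge-connected graph that does not contain infinitely many internally vertex-disjoint paths between any two of its vertices. A subdivided $\Pi$-graph is a graph $G$ that is a subdivision of a $\Pi$-graph $\Gamma$ (each edge of $\Gamma$ replaced by a path whose inner vertices are new); the vertices of $G$ corresponding to vertices of $\Gamma$ are its branch vertices. For a graph $H$ and a set $X\subseteq V(H)$ with $H[X]$ connected, $H/X$ denotes the graph obtained from $H$ by contracting $X$ to a single new vertex, itself denoted $X$: its vertex set is $(V(H)\setminus X)\cup\{X\}$, it contains all edges of $H-X$, and $X$ is adjacent to exactly those vertices outside $X$ that have a neighbour in $X$. *)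

theory Defs
  imports Main
begin

text \<open>Simple (possibly infinite) graphs: a vertex set and a set of 2-element edges.\<close>
record 'a graph =
  verts :: "'a set"
  edges :: "'a set set"

definition wf_graph :: "'a graph \<Rightarrow> bool" where
  "wf_graph G \<longleftrightarrow> (\<forall>e\<in>edges G. card e = 2 \<and> e \<subseteq> verts G)"

definition subgraph :: "'a graph \<Rightarrow> 'a graph \<Rightarrow> bool" where
  "subgraph H G \<longleftrightarrow> wf_graph H \<and> verts H \<subseteq> verts G \<and> edges H \<subseteq> edges G"

definition induced :: "'a graph \<Rightarrow> 'a set \<Rightarrow> 'a graph" where
  "induced H X = \<lparr>verts = X, edges = {e \<in> edges H. e \<subseteq> X}\<rparr>"

definition adj :: "'a graph \<Rightarrow> ('a \<times> 'a) set" where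
  "adj G = {(a, b). {a, b} \<in> edges G}"

definition connected_graph :: "'a graph \<Rightarrow> bool" where
  "connected_graph G \<longleftrightarrow> (\<forall>x\<in>verts G. \<forall>y\<in>verts G. (x, y) \<in> (adj G)\<^sup>*)"

text \<open>Paths as lists of distinct vertices, consecutive ones adjacent.\<close>
definition gpath :: "'a graph \<Rightarrow> 'a list \<Rightarrow> bool" where
  "gpath G p \<longleftrightarrow> p \<noteq> [] \<and> distinct p \<and> set p \<subseteq> verts G \<and>
     (\<forall>i. Suc i < length p \<longrightarrow> {p ! i, p ! Suc i} \<in> edges G)"

definition inner :: "'a list \<Rightarrow> 'a set" where
  "inner p = set (butlast (tl p))"

definition path_edges :: "'a list \<Rightarrow> 'a set set" where
  "path_edges p = {{p ! i, p ! Suc i} | i. Suc i < length p}"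

definition inf_edge_connected :: "'a graph \<Rightarrow> bool" where
  "inf_edge_connected G \<longleftrightarrow> (\<exists>x\<in>verts G. \<exists>y\<in>verts G. x \<noteq> y) \<and>
     (\<forall>F. finite F \<longrightarrow> connected_graph \<lparr>verts = verts G, edges = edges G - F\<rparr>)"

definition pi_graph :: "'a graph \<Rightarrow> bool" where
  "pi_graph G \<longleftrightarrow> wf_graph G \<and> inf_edge_connected G \<and>
     (\<forall>x\<in>verts G. \<forall>y\<in>verts G. x \<noteq> y \<longrightarrow>
        \<not> (\<exists>Ps. infinite Ps \<and> (\<forall>p\<in>Ps. gpath G p \<and> hd p = x \<and> last p = y) \<and>
               (\<forall>p\<in>Ps. \<forall>q\<in>Ps. p \<noteq> q \<longrightarrow> inner p \<inter> inner q = {})))"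

text \<open>G is a subdivision of Gamma, where the vertices of Gamma are themselves
  the branch vertices of G (no loss of generality, up to relabelling).\<close>
definition subdivision_of :: "'a graph \<Rightarrow> 'a graph \<Rightarrow> bool" where
  "subdivision_of G \<Gamma> \<longleftrightarrow> wf_graph G \<and> wf_graph \<Gamma> \<and> verts \<Gamma> \<subseteq> verts G \<and>
     (\<exists>P. (\<forall>e\<in>edges \<Gamma>. gpath G (P e) \<and> {hd (P e), last (P e)} = e \<and>
                         inner (P e) \<inter> verts \<Gamma> = {}) \<and>
          (\<forall>e\<in>edges \<Gamma>. \<forall>e'\<in>edges \<Gamma>. e \<noteq> e' \<longrightarrow> inner (P e) \<inter> inner (P e') = {}) \<and>
          verts G = verts \<Gamma> \<union> (\<Union>e\<in>edges \<Gamma>. inner (P e)) \<and>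
          edges G = (\<Union>e\<in>edges \<Gamma>. path_edges (P e)))"

text \<open>G is a subdivided Pi-graph with branch vertex set B.\<close>
definition subdivided_pi :: "'a graph \<Rightarrow> 'a set \<Rightarrow> bool" where
  "subdivided_pi G B \<longleftrightarrow> (\<exists>\<Gamma>. verts \<Gamma> = B \<and> pi_graph \<Gamma> \<and> subdivision_of G \<Gamma>)"

text \<open>Contraction H/X: a vertex w outside X is represented by {w}, the new vertex by X.\<close>
definition contract :: "'a graph \<Rightarrow> 'a set \<Rightarrow> 'a set graph" where
  "contract H X = \<lparr>verts = (\<lambda>w. {w}) ` (verts H - X) \<union> {X},
     edges = {{{a}, {b}} | a b. {a, b} \<in> edges H \<and> a \<notin> X \<and> b \<notin> X}
           \<union> {{X, {w}} | w. w \<in> verts H - X \<and> (\<exists>x\<in>X. {x, w} \<in> edges H)}\<rparr>"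

end

theory Submission
  imports Defs "HOL-Library.Disjoint_Sets"
begin

text \<open>In a subdivided \<open>\<Pi>\<close>-graph any two vertices are separated by finitely many vertices and edges:
  some vertex set \<open>A\<close> contains one of them but not the other, and only finitely many edges leave \<open>A\<close>
  once a finite set \<open>S\<close> of other vertices is deleted. Take such \<open>A\<close> and \<open>S\<close> for \<open>u \<in> A\<close> and
  \<open>v \<notin> A\<close>. As \<open>u\<close> and \<open>v\<close> are not separated by finitely many edges, there is a \<open>u\<close>--\<open>v\<close> path whose
  first and last vertices \<open>s\<close>, \<open>t\<close> in \<open>S\<close> are not separated by finitely many edges from \<open>u\<close> inside
  \<open>A \<union> {s}\<close>, respectively from \<open>v\<close> outside \<open>A - {t}\<close>; its set of inner vertices serves as \<open>X\<close>.

  It remains to find, in a graph with such finite separators, a subdivided \<open>\<Pi>\<close>-graph around an edge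
  \<open>xy\<close> whose ends are not separated by finitely many edges. Let \<open>U\<close> be the set of vertices that no
  finite edge set separates from \<open>x\<close>. A vertex outside \<open>U\<close> can be cut off from \<open>U\<close> by finitely many
  edges, and so can all paths without inner vertices in \<open>U\<close> between two given vertices of \<open>U\<close>. Hence
  finitely many such paths never block the construction of further ones that have new inner vertices
  and new pairs of ends, and countably many steps suffice.\<close>

section \<open>Paths\<close>

lemma wf_graph_edgeE:
  assumes "wf_graph G" "e \<in> edges G"
  obtains a b where "e = {a, b}" "a \<noteq> b" "a \<in> verts G" "b \<in> verts G"
  using assms unfolding wf_graph_def card_2_iff by (metis insert_subset)

lemma path_edges_simps [simp]:
  "path_edges [] = {}" "path_edges [a] = {}"
  "path_edges (a # b # p) = insert {a, b} (path_edges (b # p))"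
proof -
  show "path_edges (a # b # p) = insert {a, b} (path_edges (b # p))"
  proof (rule set_eqI)
    fix e
    have "e \<in> path_edges (a # b # p) \<longleftrightarrow>
        (\<exists>i<Suc (length p). e = {(a # b # p) ! i, (b # p) ! i})"
      by (auto simp: path_edges_def)
    also have "\<dots> \<longleftrightarrow> e = {a, b} \<or> (\<exists>i<length p. e = {(b # p) ! i, p ! i})"
      unfolding Ex_less_Suc2 by simp
    also have "\<dots> \<longleftrightarrow> e \<in> insert {a, b} (path_edges (b # p))"
      by (auto simp: path_edges_def)
    finally show "e \<in> path_edges (a # b # p) \<longleftrightarrow> e \<in> insert {a, b} (path_edges (b # p))" .
  qed
qed (simp_all add: path_edges_def)

lemma path_edges_append:
  "path_edges (p @ c # q) = path_edges (p @ [c]) \<union> path_edges (c # q)"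
proof (induction p)
  case (Cons a p)
  then show ?case by (cases p) auto
qed simp

lemma path_edges_snoc: "p \<noteq> [] \<Longrightarrow> path_edges (p @ [d]) = insert {last p, d} (path_edges p)"
  by (induction p rule: induct_list012) auto

lemma path_edges_rev: "path_edges (rev p) = path_edges p"
proof (induction p)
  case (Cons a p)
  then show ?case
    using path_edges_snoc[of "rev p" a] by (cases p) (auto simp: insert_commute)
qed simp

lemma path_edges_tl: "path_edges (tl p) \<subseteq> path_edges p"
  by (induction p rule: induct_list012) auto

lemma path_edges_butlast: "path_edges (butlast p) \<subseteq> path_edges p"
proof (cases p rule: rev_cases)
  case (snoc q a)
  then show ?thesis
    by (cases "q = []") (auto simp: path_edges_snoc)
qed simp

lemma set_eq_Union_path_edges: "p \<noteq> [] \<Longrightarrow> set p = insert (hd p) (\<Union>(path_edges p))"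
  by (induction p rule: induct_list012) auto

lemma path_edges_subset_set: "e \<in> path_edges p \<Longrightarrow> e \<subseteq> set p"
  by (auto simp: path_edges_def)

lemma finite_path_edges: "finite (path_edges p)"
  by (induction p rule: induct_list012) simp_all

lemma card_path_edge: "distinct p \<Longrightarrow> e \<in> path_edges p \<Longrightarrow> card e = 2"
  by (auto simp: path_edges_def nth_eq_iff_index_eq)

definition ends :: "'a list \<Rightarrow> 'a set" where
  "ends p = {hd p, last p}"

lemma set_eq_ends_Un_inner: "p \<noteq> [] \<Longrightarrow> hd p \<noteq> last p \<Longrightarrow> set p = ends p \<union> inner p"
  by (cases p; cases "tl p" rule: rev_cases) (auto simp: ends_def inner_def)

lemma inner_Cons_snoc [simp]: "inner (a # p @ [b]) = set p"
  by (simp add: inner_def)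

lemma ends_Cons_snoc [simp]: "ends (a # p @ [b]) = {a, b}"
  by (simp add: ends_def)

lemma inner_rev: "inner (rev p) = inner p"
  by (cases p; cases "tl p" rule: rev_cases) (auto simp: inner_def)

lemma ends_not_inner: "p \<noteq> [] \<Longrightarrow> distinct p \<Longrightarrow> ends p \<inter> inner p = {}"
  by (cases p; cases "tl p" rule: rev_cases) (auto simp: ends_def inner_def)

lemma shared_edge_eq_ends:
  assumes "distinct p" "e \<in> path_edges p" "e \<in> path_edges q" "set p \<inter> set q \<subseteq> ends p"
  shows "e = ends p"
proof (rule card_seteq)
  show "e \<subseteq> ends p"
    using assms(2-4) path_edges_subset_set by blast
  show "card (ends p) \<le> card e"
    using card_path_edge[OF assms(1,2)] by (simp add: ends_def card_insert_if)
qed (simp add: ends_def)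

definition is_path :: "'a set set \<Rightarrow> 'a \<Rightarrow> 'a \<Rightarrow> 'a list \<Rightarrow> bool" where
  "is_path E a b p \<longleftrightarrow> p \<noteq> [] \<and> hd p = a \<and> last p = b \<and> distinct p \<and> path_edges p \<subseteq> E"

lemma gpath_iff:
  "gpath G p \<longleftrightarrow> p \<noteq> [] \<and> distinct p \<and> set p \<subseteq> verts G \<and> path_edges p \<subseteq> edges G"
  unfolding gpath_def path_edges_def by blast

lemma gpath_iff_is_path:
  assumes "wf_graph G" "a \<in> verts G"
  shows "gpath G p \<and> hd p = a \<and> last p = b \<longleftrightarrow> is_path (edges G) a b p"
proof -
  have "set p \<subseteq> verts G" if "p \<noteq> []" "hd p = a" "path_edges p \<subseteq> edges G"
    using set_eq_Union_path_edges[OF that(1)] that assms by (auto simp: wf_graph_def)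
  then show ?thesis
    by (auto simp: gpath_iff is_path_def)
qed

lemma is_path_mono: "is_path E a b p \<Longrightarrow> E \<subseteq> E' \<Longrightarrow> is_path E' a b p"
  by (auto simp: is_path_def)

lemma is_path_rev: "is_path E a b p \<Longrightarrow> is_path E b a (rev p)"
  by (simp add: is_path_def path_edges_rev hd_rev last_rev)

lemma is_path_ConsE:
  assumes "is_path E a b p" "a \<noteq> b"
  obtains q where "p = a # q @ [b]"
  using assms unfolding is_path_def
  by (cases p; cases "tl p" rule: rev_cases) auto

lemma set_is_path: "is_path E a b p \<Longrightarrow> a \<noteq> b \<Longrightarrow> set p = {a, b} \<union> inner p"
  using set_eq_ends_Un_inner[of p] by (auto simp: is_path_def ends_def)

lemma is_path_eq_edge:
  assumes "is_path E a b p" "a \<noteq> b" "{a, b} \<in> path_edges p"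
  shows "p = [a, b]"
proof -
  obtain q where p_eq: "p = a # q @ [b]"
    using assms(1,2) by (rule is_path_ConsE)
  moreover have False if "q = c # r" for c r
    using assms path_edges_subset_set[of "{a, b}" "c # r @ [b]"] p_eq that
    by (auto simp: is_path_def doubleton_eq_iff)
  ultimately show ?thesis
    by (cases q) auto
qed

section \<open>Cuts and reachability\<close>

definition edge_cut :: "'a set set \<Rightarrow> 'a set \<Rightarrow> 'a set set" where
  "edge_cut E A = {{a, b} | a b. a \<in> A \<and> b \<notin> A \<and> {a, b} \<in> E}"

lemma doubleton_in_edge_cut_iff: "{a, b} \<in> edge_cut E A \<longleftrightarrow> {a, b} \<in> E \<and> (a \<in> A \<longleftrightarrow> b \<notin> A)"
  unfolding edge_cut_def by (cases "a \<in> A") (auto simp: doubleton_eq_iff; metis insert_commute)+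

lemma edge_cut_Compl: "edge_cut E (- A) = edge_cut E A"
  by (auto simp: edge_cut_def; metis insert_commute)

lemma path_edges_meet_edge_cut:
  assumes "path_edges p \<subseteq> E" "a \<in> set p" "b \<in> set p" "a \<in> A \<longleftrightarrow> b \<notin> A"
  shows "path_edges p \<inter> edge_cut E A \<noteq> {}"
  using assms
proof (induction p arbitrary: a b rule: induct_list012)
  case (3 c d p)
  show ?case
  proof (cases "c \<in> A \<longleftrightarrow> d \<in> A")
    case True
    then have "path_edges (d # p) \<inter> edge_cut E A \<noteq> {}"
      using 3 by (metis insert_subset list.set_intros(1) path_edges_simps(3) set_ConsD)
    then show ?thesis
      by auto
  next
    case False
    then have "{c, d} \<in> edge_cut E A"
      using "3.prems"(1) by (simp add: doubleton_in_edge_cut_iff)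
    then show ?thesis
      by simp
  qed
qed auto

definition reach :: "'a set set \<Rightarrow> ('a \<times> 'a) set" where
  "reach E = {(a, b). {a, b} \<in> E}\<^sup>*"

lemma reach_mono: "(a, b) \<in> reach E \<Longrightarrow> E \<subseteq> E' \<Longrightarrow> (a, b) \<in> reach E'"
  unfolding reach_def by (erule rev_subsetD, rule rtrancl_mono) auto

lemma reach_step: "{a, b} \<in> E \<Longrightarrow> (b, c) \<in> reach E \<Longrightarrow> (a, c) \<in> reach E"
  unfolding reach_def by (rule converse_rtrancl_into_rtrancl) simp_all

lemma connected_graph_iff_reach:
  "connected_graph G \<longleftrightarrow> (\<forall>x\<in>verts G. \<forall>y\<in>verts G. (x, y) \<in> reach (edges G))"
  by (simp add: connected_graph_def adj_def reach_def)

lemma reach_iff_edge_cut: "(a, b) \<in> reach E \<longleftrightarrow> (\<forall>A. a \<in> A \<longrightarrow> edge_cut E A = {} \<longrightarrow> b \<in> A)"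
proof (intro iffI allI impI)
  fix A assume "(a, b) \<in> reach E" "a \<in> A" "edge_cut E A = {}"
  then show "b \<in> A"
    unfolding reach_def by (induction rule: rtrancl_induct) (auto simp: edge_cut_def)
next
  assume closed: "\<forall>A. a \<in> A \<longrightarrow> edge_cut E A = {} \<longrightarrow> b \<in> A"
  have "edge_cut E (reach E `` {a}) = {}"
    unfolding reach_def by (auto simp: edge_cut_def dest: rtrancl_into_rtrancl)
  then show "(a, b) \<in> reach E"
    using closed[rule_format, of "reach E `` {a}"] by (simp add: reach_def)
qed

lemma ex_path_if_reach:
  assumes "(a, b) \<in> reach E"
  shows "\<exists>p. is_path E a b p"
  using assms unfolding reach_def
proof (induction rule: rtrancl_induct)
  case base
  show ?case
    by (intro exI[of _ "[a]"]) (simp add: is_path_def)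
next
  case (step c d)
  then obtain p where path: "is_path E a c p"
    by blast
  show ?case
  proof (cases "d \<in> set p")
    case True
    then obtain r s where "p = r @ d # s"
      by (meson split_list)
    then show ?thesis
      using path path_edges_append[of r d s]
      by (intro exI[of _ "r @ [d]"]) (cases r; auto simp: is_path_def)
  next
    case False
    then show ?thesis
      using path step.hyps(2)
      by (intro exI[of _ "p @ [d]"]) (auto simp: is_path_def path_edges_snoc)
  qed
qed

lemma connected_graph_induced_inner:
  assumes "path_edges p \<subseteq> edges G"
  shows "connected_graph (induced G (inner p))"
  unfolding connected_graph_iff_reach reach_iff_edge_cut
proof (intro ballI allI impI, rule ccontr)
  define q where "q = butlast (tl p)"
  have "path_edges q \<subseteq> path_edges p"
    using path_edges_butlast[of "tl p"] path_edges_tl[of p] by (simp add: q_def)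
  then have "path_edges q \<subseteq> edges (induced G (inner p))"
    using assms path_edges_subset_set by (fastforce simp: induced_def inner_def q_def)
  moreover fix x y A
  assume "x \<in> verts (induced G (inner p))" "y \<in> verts (induced G (inner p))" "x \<in> A" "y \<notin> A"
  then have "x \<in> set q" "y \<in> set q" "x \<in> A \<longleftrightarrow> y \<notin> A"
    by (simp_all add: induced_def inner_def q_def)
  ultimately have "path_edges q \<inter> edge_cut (edges (induced G (inner p))) A \<noteq> {}"
    by (rule path_edges_meet_edge_cut)
  moreover assume "edge_cut (edges (induced G (inner p))) A = {}"
  ultimately show False
    by simp
qed

definition edge_inseparable :: "'a set set \<Rightarrow> 'a \<Rightarrow> 'a \<Rightarrow> bool" where
  "edge_inseparable E x y \<longleftrightarrow> (\<forall>A. finite (edge_cut E A) \<longrightarrow> (x \<in> A \<longleftrightarrow> y \<in> A))"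

lemma edge_inseparable_refl: "edge_inseparable E x x"
  by (simp add: edge_inseparable_def)

lemma edge_inseparable_mono:
  assumes "edge_inseparable E x y" "E \<subseteq> E'"
  shows "edge_inseparable E' x y"
proof -
  have "edge_cut E A \<subseteq> edge_cut E' A" for A
    using assms(2) by (auto simp: edge_cut_def)
  then show ?thesis
    using assms(1) by (simp add: edge_inseparable_def) (meson finite_subset)
qed

lemma edge_inseparable_iff_reach:
  "edge_inseparable E x y \<longleftrightarrow> (\<forall>F. finite F \<longrightarrow> (x, y) \<in> reach (E - F))"
proof (intro iffI allI impI)
  fix F :: "'a set set"
  assume inseparable: "edge_inseparable E x y" and "finite F"
  show "(x, y) \<in> reach (E - F)"
    unfolding reach_iff_edge_cut
  proof (intro allI impI)
    fix A assume "x \<in> A" "edge_cut (E - F) A = {}"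
    then have "edge_cut E A \<subseteq> F"
      by (auto simp: edge_cut_def)
    then show "y \<in> A"
      using inseparable \<open>finite F\<close> \<open>x \<in> A\<close> by (auto simp: edge_inseparable_def finite_subset)
  qed
next
  assume reach: "\<forall>F. finite F \<longrightarrow> (x, y) \<in> reach (E - F)"
  have closed: "y \<in> A" if "x \<in> A" "finite (edge_cut E A)" for A
  proof -
    have "edge_cut (E - edge_cut E A) A = {}"
      by (auto simp: edge_cut_def)
    then show ?thesis
      using reach that by (auto simp: reach_iff_edge_cut)
  qed
  show "edge_inseparable E x y"
    unfolding edge_inseparable_def
  proof (intro allI impI)
    fix A assume "finite (edge_cut E A)"
    then show "x \<in> A \<longleftrightarrow> y \<in> A"
      using closed[of A] closed[of "- A"] by (auto simp: edge_cut_Compl)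
  qed
qed

lemma ex_path_if_edge_inseparable:
  "edge_inseparable E x y \<Longrightarrow> finite F \<Longrightarrow> \<exists>p. is_path (E - F) x y p"
  by (simp add: edge_inseparable_iff_reach ex_path_if_reach)

lemma ex_finite_edges_blocking_paths:
  "\<exists>F. finite F \<and> (\<forall>p y. path_edges p \<subseteq> E - F \<longrightarrow> y \<in> set p \<longrightarrow> z \<in> set p \<longrightarrow>
    edge_inseparable E x y \<longrightarrow> edge_inseparable E x z)"
proof (cases "edge_inseparable E x z")
  case False
  then obtain A where separator: "finite (edge_cut E A)" "x \<in> A \<longleftrightarrow> z \<notin> A"
    by (auto simp: edge_inseparable_def)
  have "\<not> edge_inseparable E x y"
    if path: "path_edges p \<subseteq> E - edge_cut E A" "y \<in> set p" "z \<in> set p" for p y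
  proof
    assume "edge_inseparable E x y"
    then have "y \<in> A \<longleftrightarrow> z \<notin> A"
      using separator by (simp add: edge_inseparable_def)
    then have "path_edges p \<inter> edge_cut E A \<noteq> {}"
      using path by (intro path_edges_meet_edge_cut[of p E y z]) auto
    then show False
      using path(1) by blast
  qed
  then show ?thesis
    using separator(1) by blast
qed blast

lemma inf_edge_connected_iff:
  "inf_edge_connected G \<longleftrightarrow> (\<exists>x\<in>verts G. \<exists>y\<in>verts G. x \<noteq> y) \<and>
    (\<forall>x\<in>verts G. \<forall>y\<in>verts G. edge_inseparable (edges G) x y)"
  unfolding inf_edge_connected_def connected_graph_iff_reach edge_inseparable_iff_reach by auto

lemma finite_meeting_disjoint_family:
  assumes "disjoint_family_on f I" "finite S"
  shows "finite {i \<in> I. f i \<inter> S \<noteq> {}}"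
proof (rule ccontr)
  let ?J = "{i \<in> I. f i \<inter> S \<noteq> {}}"
  assume "infinite ?J"
  moreover have "disjoint_family_on (\<lambda>i. f i \<inter> S) ?J"
    using assms(1) by (auto simp: disjoint_family_on_def)
  ultimately have "infinite (\<Union>i\<in>?J. f i \<inter> S)"
    by (intro infinite_disjoint_family_imp_infinite_UNION) auto
  then show False
    using assms(2) by (meson UN_least finite_subset inf_le2)
qed

lemma edge_inseparable_if_infinitely_reach:
  fixes E :: "'a set set"
  assumes "infinite I" "disjoint_family_on D I"
    and "\<And>i. i \<in> I \<Longrightarrow> D i \<subseteq> E" "\<And>i. i \<in> I \<Longrightarrow> (x, y) \<in> reach (D i)"
  shows "edge_inseparable E x y"
  unfolding edge_inseparable_iff_reach
proof (intro allI impI)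
  fix F :: "'a set set"
  assume "finite F"
  then have "finite {i \<in> I. D i \<inter> F \<noteq> {}}"
    by (rule finite_meeting_disjoint_family[OF assms(2)])
  then have "\<not> I \<subseteq> {i \<in> I. D i \<inter> F \<noteq> {}}"
    using assms(1) finite_subset by blast
  then obtain i where "i \<in> I" "D i \<inter> F = {}"
    by blast
  then have "D i \<subseteq> E - F"
    using assms(3)[of i] by blast
  with assms(4)[OF \<open>i \<in> I\<close>] show "(x, y) \<in> reach (E - F)"
    by (rule reach_mono)
qed

section \<open>Separation by finitely many vertices and edges\<close>

definition avoiding :: "'a set \<Rightarrow> 'a set set \<Rightarrow> 'a set set" where
  "avoiding S E = {e \<in> E. e \<inter> S = {}}"

lemma path_edges_avoiding:
  "path_edges p \<subseteq> E \<Longrightarrow> set p \<inter> S = {} \<Longrightarrow> path_edges p \<subseteq> avoiding S E"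
  using path_edges_subset_set by (fastforce simp: avoiding_def)

lemma path_edges_meet_separator:
  assumes "path_edges p \<subseteq> E" "set p \<inter> S = {}" "a \<in> set p" "b \<in> set p" "a \<in> A \<longleftrightarrow> b \<notin> A"
  shows "path_edges p \<inter> edge_cut (avoiding S E) A \<noteq> {}"
  using path_edges_avoiding[OF assms(1,2)] assms(3-5) by (rule path_edges_meet_edge_cut)

lemma finite_crossing_paths:
  assumes "finite S" "finite (edge_cut (avoiding S E) A)"
    and inner: "disjoint_family_on (\<lambda>i. inner (P i)) I"
    and edges: "disjoint_family_on (\<lambda>i. path_edges (P i)) I"
    and paths: "\<And>i. i \<in> I \<Longrightarrow> P i \<noteq> [] \<and> path_edges (P i) \<subseteq> E"
    and crossing: "\<And>i. i \<in> I \<Longrightarrow> ends (P i) \<inter> S = {} \<and> (hd (P i) \<in> A \<longleftrightarrow> last (P i) \<notin> A)"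
  shows "finite I"
proof (rule finite_subset)
  let ?through_S = "{i \<in> I. inner (P i) \<inter> S \<noteq> {}}"
    and ?through_cut = "{i \<in> I. path_edges (P i) \<inter> edge_cut (avoiding S E) A \<noteq> {}}"
  show "I \<subseteq> ?through_S \<union> ?through_cut"
  proof
    fix i assume "i \<in> I"
    then have set_P: "set (P i) = ends (P i) \<union> inner (P i)"
      using paths[of i] crossing[of i] by (intro set_eq_ends_Un_inner) auto
    show "i \<in> ?through_S \<union> ?through_cut"
    proof (cases "inner (P i) \<inter> S = {}")
      case True
      then have "set (P i) \<inter> S = {}"
        using crossing[OF \<open>i \<in> I\<close>] set_P by blast
      then have "path_edges (P i) \<inter> edge_cut (avoiding S E) A \<noteq> {}"
        using paths[OF \<open>i \<in> I\<close>] crossing[OF \<open>i \<in> I\<close>]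
        by (intro path_edges_meet_separator[of _ _ _ "hd (P i)" "last (P i)"]) auto
      then show ?thesis
        using \<open>i \<in> I\<close> by blast
    qed (use \<open>i \<in> I\<close> in blast)
  qed
  show "finite (?through_S \<union> ?through_cut)"
    using assms(1,2) inner edges by (simp add: finite_meeting_disjoint_family)
qed

lemma is_path_avoiding: "is_path (avoiding S E) a b p \<Longrightarrow> a \<notin> S \<Longrightarrow> set p \<inter> S = {}"
  using set_eq_Union_path_edges[of p] by (auto simp: is_path_def avoiding_def)

text \<open>Deleting finitely many vertices along with finitely many edges makes the notion stable under
  subdivisions and under contractions of finite sets.\<close>

definition finitely_separated :: "'a set set \<Rightarrow> 'a \<Rightarrow> 'a \<Rightarrow> bool" where
  "finitely_separated E x y \<longleftrightarrow>
    (\<exists>A S. finite S \<and> x \<in> A \<and> y \<notin> A \<and> x \<notin> S \<and> y \<notin> S \<and> finite (edge_cut (avoiding S E) A))"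

definition finitely_separable :: "'a graph \<Rightarrow> bool" where
  "finitely_separable G \<longleftrightarrow>
    (\<forall>x\<in>verts G. \<forall>y\<in>verts G. x \<noteq> y \<longrightarrow> finitely_separated (edges G) x y)"

lemma finitely_separatedE:
  assumes "finitely_separated E x y"
  obtains A S where "finite S" "x \<in> A" "y \<notin> A" "x \<notin> S" "y \<notin> S" "finite (edge_cut (avoiding S E) A)"
  using assms unfolding finitely_separated_def by blast

lemma finitely_separated_sym:
  assumes "finitely_separated E x y"
  shows "finitely_separated E y x"
proof -
  obtain A S where "finite S" "x \<in> A" "y \<notin> A" "x \<notin> S" "y \<notin> S" "finite (edge_cut (avoiding S E) A)"
    using assms by (rule finitely_separatedE)
  then show ?thesis
    unfolding finitely_separated_def
    by (intro exI[of _ "- A"] exI[of _ S]) (simp add: edge_cut_Compl)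
qed

lemma finitely_separated_mono:
  assumes "finitely_separated E x y" "E' \<subseteq> E"
  shows "finitely_separated E' x y"
proof -
  have "edge_cut (avoiding S E') A \<subseteq> edge_cut (avoiding S E) A" for S A
    using assms(2) by (auto simp: edge_cut_def avoiding_def)
  then show ?thesis
    using assms(1) unfolding finitely_separated_def by (meson finite_subset)
qed

lemma finitely_separable_subgraph:
  "finitely_separable G \<Longrightarrow> subgraph H G \<Longrightarrow> finitely_separable H"
  unfolding finitely_separable_def subgraph_def
  using finitely_separated_mono by (meson subsetD)

lemma edge_cut_Inter_subset:
  assumes "\<And>z. z \<in> Z \<Longrightarrow> z \<notin> A z \<and> z \<notin> S z"
  shows "edge_cut (avoiding ((\<Union>z\<in>Z. S z) - Z) E) (\<Inter>z\<in>Z. A z)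
    \<subseteq> (\<Union>z\<in>Z. edge_cut (avoiding (S z) E) (A z))"
proof
  let ?A = "\<Inter>z\<in>Z. A z" and ?S = "(\<Union>z\<in>Z. S z) - Z"
  fix e assume "e \<in> edge_cut (avoiding ?S E) ?A"
  then obtain a b where crossing: "e = {a, b}" "e \<in> E" "a \<in> ?A" "b \<notin> ?A" "a \<notin> ?S" "b \<notin> ?S"
    by (auto simp: edge_cut_def avoiding_def)
  have "a \<notin> Z"
    using crossing(3) assms by blast
  then have a_avoids: "a \<notin> S z" if "z \<in> Z" for z
    using crossing(5) that by blast
  obtain z where z_separates: "z \<in> Z" "b \<notin> A z" "b \<notin> S z"
  proof (cases "b \<in> Z")
    case True
    then show ?thesis
      using assms that by blast
  next
    case False
    then show ?thesis
      using crossing(4,6) that by blast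
  qed
  then have "e \<in> edge_cut (avoiding (S z) E) (A z)"
    using crossing a_avoids by (auto simp: doubleton_in_edge_cut_iff avoiding_def)
  then show "e \<in> (\<Union>z\<in>Z. edge_cut (avoiding (S z) E) (A z))"
    using z_separates(1) by blast
qed

lemma finitely_separated_finite_set:
  assumes "finite Z" "\<And>z. z \<in> Z \<Longrightarrow> finitely_separated E x z"
  obtains A S where "finite S" "x \<in> A" "x \<notin> S" "Z \<inter> (A \<union> S) = {}"
    "finite (edge_cut (avoiding S E) A)"
proof -
  obtain A S where separator: "\<And>z. z \<in> Z \<Longrightarrow> finite (S z) \<and> x \<in> A z \<and> z \<notin> A z \<and> x \<notin> S z \<and>
      z \<notin> S z \<and> finite (edge_cut (avoiding (S z) E) (A z))"
    using assms(2) unfolding finitely_separated_def by metis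
  let ?A = "\<Inter>z\<in>Z. A z" and ?S = "(\<Union>z\<in>Z. S z) - Z"
  have "finite (\<Union>z\<in>Z. edge_cut (avoiding (S z) E) (A z))" "finite ?S"
    using assms(1) separator by simp_all
  then have "finite (edge_cut (avoiding ?S E) ?A)" "finite ?S"
    using separator by (auto intro: finite_subset[OF edge_cut_Inter_subset])
  then show thesis
    using separator by (intro that[of ?S ?A]) auto
qed

section \<open>Independent paths\<close>

definition independent_paths :: "'a set set \<Rightarrow> 'a \<Rightarrow> 'a \<Rightarrow> 'a list set \<Rightarrow> bool" where
  "independent_paths E x y Ps \<longleftrightarrow> (\<forall>p\<in>Ps. is_path E x y p) \<and> disjoint_family_on inner Ps"

lemma independent_paths_edge_disjoint:
  assumes "independent_paths E x y Ps" "x \<noteq> y"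
  shows "disjoint_family_on path_edges Ps"
  unfolding disjoint_family_on_def
proof (intro ballI impI, rule ccontr)
  fix p q assume "p \<in> Ps" "q \<in> Ps" "p \<noteq> q" "path_edges p \<inter> path_edges q \<noteq> {}"
  then obtain e where shared_edge: "e \<in> path_edges p" "e \<in> path_edges q"
    by blast
  have paths: "is_path E x y p" "is_path E x y q"
    using assms(1) \<open>p \<in> Ps\<close> \<open>q \<in> Ps\<close> by (auto simp: independent_paths_def)
  moreover have "inner p \<inter> inner q = {}"
    using assms(1) \<open>p \<in> Ps\<close> \<open>q \<in> Ps\<close> \<open>p \<noteq> q\<close>
    by (auto simp: independent_paths_def disjoint_family_on_def)
  ultimately have "set p \<inter> set q \<subseteq> ends p"
    using assms(2) by (auto simp: set_is_path is_path_def ends_def)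
  then have "e = {x, y}"
    using shared_edge_eq_ends[of p e q] shared_edge paths by (auto simp: is_path_def ends_def)
  then have "p = q"
    using is_path_eq_edge[OF _ assms(2)] paths shared_edge by metis
  then show False
    using \<open>p \<noteq> q\<close> by contradiction
qed

lemma finite_independent_paths:
  assumes "finitely_separated E x y" "independent_paths E x y Ps"
  shows "finite Ps"
proof -
  obtain A S where separator: "finite S" "x \<in> A" "y \<notin> A" "x \<notin> S" "y \<notin> S"
    and finite_cut: "finite (edge_cut (avoiding S E) A)"
    using assms(1) by (rule finitely_separatedE)
  then have "x \<noteq> y"
    by blast
  show ?thesis
    using separator(1) finite_cut
  proof (rule finite_crossing_paths)
    show "disjoint_family_on path_edges Ps"
      using assms(2) \<open>x \<noteq> y\<close> by (rule independent_paths_edge_disjoint)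
  qed (use assms(2) separator in \<open>auto simp: independent_paths_def is_path_def ends_def\<close>)
qed

lemma ex_maximal_independent_paths:
  obtains M where "independent_paths E x y M"
    "\<And>Ps. independent_paths E x y Ps \<Longrightarrow> M \<subseteq> Ps \<Longrightarrow> Ps = M"
proof -
  have "\<exists>M\<in>Collect (independent_paths E x y).
      \<forall>Ps\<in>Collect (independent_paths E x y). M \<subseteq> Ps \<longrightarrow> Ps = M"
  proof (rule subset_Zorn')
    fix C assume chain: "subset.chain (Collect (independent_paths E x y)) C"
    then have independent: "independent_paths E x y Ps" if "Ps \<in> C" for Ps
      using that by (auto simp: subset_chain_def)
    have "inner p \<inter> inner q = {}" if p_ne_q: "p \<in> \<Union>C" "q \<in> \<Union>C" "p \<noteq> q" for p q
    proof -
      obtain Ps where "Ps \<in> C" "p \<in> Ps" "q \<in> Ps"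
        using chain p_ne_q(1,2) by (auto simp: subset_chain_def) blast
      then show ?thesis
        using independent p_ne_q(3) by (auto simp: independent_paths_def disjoint_family_on_def)
    qed
    then show "\<Union>C \<in> Collect (independent_paths E x y)"
      using independent by (auto simp: independent_paths_def disjoint_family_on_def)
  qed
  then show thesis
    using that by blast
qed

lemma not_reach_avoiding_maximal_independent_paths:
  assumes "x \<noteq> y" "independent_paths E x y M"
    and maximal: "\<And>Ps. independent_paths E x y Ps \<Longrightarrow> M \<subseteq> Ps \<Longrightarrow> Ps = M"
  shows "(x, y) \<notin> reach (avoiding (\<Union>p\<in>M. inner p) (E - {{x, y}}))"
proof
  let ?S = "\<Union>p\<in>M. inner p"
  assume "(x, y) \<in> reach (avoiding ?S (E - {{x, y}}))"
  then obtain p where path: "is_path (avoiding ?S (E - {{x, y}})) x y p"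
    using ex_path_if_reach by metis
  then have "is_path E x y p" "{x, y} \<notin> path_edges p"
    by (auto simp: is_path_def avoiding_def)
  obtain m where "p = x # m @ [y]"
    using path assms(1) by (rule is_path_ConsE)
  then have "inner p \<noteq> {}"
    using \<open>{x, y} \<notin> path_edges p\<close> by auto
  have "x \<notin> ?S"
    using assms(2) ends_not_inner by (fastforce simp: independent_paths_def is_path_def ends_def)
  then have "inner p \<inter> ?S = {}"
    using is_path_avoiding[OF path] set_is_path[OF path assms(1)] by blast
  then have "independent_paths E x y (insert p M)"
    using assms(2) \<open>is_path E x y p\<close>
    by (auto simp: independent_paths_def disjoint_family_on_def)
  then have "p \<in> M"
    using maximal by blast
  then show False
    using \<open>inner p \<inter> ?S = {}\<close> \<open>inner p \<noteq> {}\<close> by blast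
qed

lemma finitely_separated_if_finite_independent_paths:
  assumes "x \<noteq> y" "\<And>Ps. independent_paths E x y Ps \<Longrightarrow> finite Ps"
  shows "finitely_separated E x y"
proof -
  obtain M where independent: "independent_paths E x y M"
    and maximal: "\<And>Ps. independent_paths E x y Ps \<Longrightarrow> M \<subseteq> Ps \<Longrightarrow> Ps = M"
    using ex_maximal_independent_paths[of E x y] by blast
  let ?S = "\<Union>p\<in>M. inner p"
  have "finite ?S"
    using assms(2)[OF independent] by (simp add: inner_def)
  moreover have "x \<notin> ?S" "y \<notin> ?S"
    using independent ends_not_inner
    by (fastforce simp: independent_paths_def is_path_def ends_def)+
  moreover obtain A where separator: "x \<in> A" "y \<notin> A"
    and empty: "edge_cut (avoiding ?S (E - {{x, y}})) A = {}"
    using not_reach_avoiding_maximal_independent_paths[OF assms(1) independent maximal]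
    by (auto simp: reach_iff_edge_cut)
  have "edge_cut (avoiding ?S E) A \<subseteq> {{x, y}}"
    using empty by (auto simp: edge_cut_def avoiding_def)
  then have "finite (edge_cut (avoiding ?S E) A)"
    by (rule finite_subset) simp
  ultimately show ?thesis
    using separator unfolding finitely_separated_def by (intro exI[of _ A] exI[of _ ?S]) simp
qed

lemma pi_graph_iff:
  "pi_graph G \<longleftrightarrow> wf_graph G \<and> inf_edge_connected G \<and> finitely_separable G"
proof (cases "wf_graph G")
  case True
  have "(\<exists>Ps. infinite Ps \<and> (\<forall>p\<in>Ps. gpath G p \<and> hd p = x \<and> last p = y) \<and>
      (\<forall>p\<in>Ps. \<forall>q\<in>Ps. p \<noteq> q \<longrightarrow> inner p \<inter> inner q = {})) \<longleftrightarrow>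
    \<not> finitely_separated (edges G) x y" if "x \<in> verts G" "x \<noteq> y" for x y
    unfolding gpath_iff_is_path[OF True that(1)]
    using finite_independent_paths[of "edges G" x y]
      finitely_separated_if_finite_independent_paths[OF that(2), of "edges G"]
    unfolding independent_paths_def disjoint_family_on_def by blast
  then show ?thesis
    unfolding pi_graph_def finitely_separable_def by blast
qed (simp add: pi_graph_def)

section \<open>Subdivisions\<close>

locale subdivision =
  fixes G \<Gamma> :: "'a graph" and P :: "'a set \<Rightarrow> 'a list"
  assumes wf_\<Gamma>: "wf_graph \<Gamma>"
    and path: "e \<in> edges \<Gamma> \<Longrightarrow> gpath G (P e)"
    and ends_path: "e \<in> edges \<Gamma> \<Longrightarrow> ends (P e) = e"
    and inner_new: "e \<in> edges \<Gamma> \<Longrightarrow> inner (P e) \<inter> verts \<Gamma> = {}"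
    and inner_disjoint: "disjoint_family_on (\<lambda>e. inner (P e)) (edges \<Gamma>)"
    and verts_eq: "verts G = verts \<Gamma> \<union> (\<Union>e\<in>edges \<Gamma>. inner (P e))"
    and edges_eq: "edges G = (\<Union>e\<in>edges \<Gamma>. path_edges (P e))"
begin

lemma wf_G: "wf_graph G"
  using path card_path_edge path_edges_subset_set
  by (fastforce simp: wf_graph_def edges_eq gpath_def)

lemma subdivision_of: "subdivision_of G \<Gamma>"
  unfolding subdivision_of_def
  by (intro conjI exI[of _ P] ballI impI)
    (use wf_G wf_\<Gamma> path ends_path inner_new inner_disjoint verts_eq edges_eq
      in \<open>simp_all add: ends_def disjoint_family_on_def\<close>)

lemma set_path:
  assumes "e \<in> edges \<Gamma>"
  shows "set (P e) = e \<union> inner (P e)"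
proof -
  have "card (ends (P e)) = 2"
    using assms wf_\<Gamma> by (simp add: ends_path wf_graph_def)
  then have "hd (P e) \<noteq> last (P e)"
    by (auto simp: ends_def)
  then show ?thesis
    using set_eq_ends_Un_inner[of "P e"] path[OF assms] ends_path[OF assms]
    by (simp add: gpath_def)
qed

lemma path_unique_of_inner:
  assumes "e \<in> edges \<Gamma>" "e' \<in> edges \<Gamma>" "w \<in> inner (P e)" "w \<in> set (P e')"
  shows "e = e'"
proof -
  have "w \<notin> e'"
    using assms(1-3) inner_new wf_\<Gamma> by (auto simp: wf_graph_def)
  then have "w \<in> inner (P e')"
    using assms(2,4) set_path by blast
  then show ?thesis
    using inner_disjoint assms(1-3) by (auto simp: disjoint_family_on_def)
qed

lemma path_edges_disjoint: "disjoint_family_on (\<lambda>e. path_edges (P e)) (edges \<Gamma>)"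
  unfolding disjoint_family_on_def
proof (intro ballI impI, rule ccontr)
  fix e e' assume distinct_edges: "e \<in> edges \<Gamma>" "e' \<in> edges \<Gamma>" "e \<noteq> e'"
  assume "path_edges (P e) \<inter> path_edges (P e') \<noteq> {}"
  then obtain f where shared_edge: "f \<in> path_edges (P e)" "f \<in> path_edges (P e')"
    by blast
  have "set (P e) \<inter> set (P e') \<subseteq> e" "set (P e') \<inter> set (P e) \<subseteq> e'"
    using distinct_edges set_path path_unique_of_inner by blast+
  then have "f = e" "f = e'"
    using shared_edge_eq_ends[of "P e" f "P e'"] shared_edge_eq_ends[of "P e'" f "P e"]
      shared_edge distinct_edges path ends_path by (auto simp: gpath_def)
  then show False
    using distinct_edges(3) by simp
qed

lemma finite_edge_cut_branch_graph:
  assumes "finite S" "finite (edge_cut (avoiding S (edges G)) A)"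
  shows "finite (edge_cut (avoiding S (edges \<Gamma>)) A)"
  using assms
proof (rule finite_crossing_paths)
  let ?I = "edge_cut (avoiding S (edges \<Gamma>)) A"
  have "?I \<subseteq> edges \<Gamma>"
    by (auto simp: edge_cut_def avoiding_def)
  then show "disjoint_family_on (\<lambda>e. inner (P e)) ?I"
    and "disjoint_family_on (\<lambda>e. path_edges (P e)) ?I"
    using inner_disjoint path_edges_disjoint disjoint_family_on_mono by blast+
  fix e assume e_cut: "e \<in> ?I"
  with \<open>?I \<subseteq> edges \<Gamma>\<close> have "e \<in> edges \<Gamma>"
    by blast
  then show "P e \<noteq> [] \<and> path_edges (P e) \<subseteq> edges G"
    using path by (auto simp: gpath_iff)
  have "e = {hd (P e), last (P e)}"
    using ends_path[OF \<open>e \<in> edges \<Gamma>\<close>] by (simp add: ends_def)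
  then show "ends (P e) \<inter> S = {} \<and> (hd (P e) \<in> A \<longleftrightarrow> last (P e) \<notin> A)"
    using e_cut ends_path[OF \<open>e \<in> edges \<Gamma>\<close>]
      doubleton_in_edge_cut_iff[of "hd (P e)" "last (P e)" "avoiding S (edges \<Gamma>)" A]
    by (simp add: avoiding_def)
qed

lemma edge_inseparable_subdivision:
  assumes "edge_inseparable (edges \<Gamma>) x y"
  shows "edge_inseparable (edges G) x y"
  using assms finite_edge_cut_branch_graph[of "{}"]
  by (simp add: edge_inseparable_def avoiding_def)

lemma finitely_separated_branch_graph:
  "finitely_separated (edges G) x y \<Longrightarrow> finitely_separated (edges \<Gamma>) x y"
  unfolding finitely_separated_def using finite_edge_cut_branch_graph by blast

definition spread :: "'a set \<Rightarrow> 'a set" where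
  "spread A = A \<union> (\<Union>e\<in>{e \<in> edges \<Gamma>. e \<inter> A \<noteq> {}}. inner (P e))"

lemma spread_Int_branch_verts: "A \<subseteq> verts \<Gamma> \<Longrightarrow> spread A \<inter> verts \<Gamma> = A"
  using inner_new by (auto simp: spread_def)

lemma edge_cut_spread_subset:
  assumes "A \<subseteq> verts \<Gamma> - S"
  shows "edge_cut (avoiding S (edges G)) (spread A)
    \<subseteq> (\<Union>e\<in>edge_cut (avoiding S (edges \<Gamma>)) A. path_edges (P e))"
proof
  fix f assume "f \<in> edge_cut (avoiding S (edges G)) (spread A)"
  then obtain c d where crossing: "f = {c, d}" "c \<in> spread A" "d \<notin> spread A" "d \<notin> S" "f \<in> edges G"
    by (auto simp: edge_cut_def avoiding_def)
  then obtain e where f_on_path: "e \<in> edges \<Gamma>" "f \<in> path_edges (P e)"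
    by (auto simp: edges_eq)
  then have in_path: "c \<in> set (P e)" "d \<in> set (P e)"
    using crossing(1) path_edges_subset_set by blast+
  have "e \<inter> A \<noteq> {}"
  proof (cases "c \<in> A")
    case True
    then have "c \<in> e"
      using assms in_path(1) set_path[OF f_on_path(1)] inner_new[OF f_on_path(1)] by blast
    with True show ?thesis
      by blast
  next
    case False
    then show ?thesis
      using crossing(2) f_on_path(1) in_path(1) path_unique_of_inner by (auto simp: spread_def)
  qed
  then obtain a where a_end: "a \<in> e" "a \<in> A"
    by blast
  then have "d \<in> e" "d \<notin> A"
    using crossing(3) f_on_path(1) in_path(2) set_path by (auto simp: spread_def)
  moreover from this have "e = {a, d}"
    using a_end f_on_path(1) wf_\<Gamma> card_2_iff[of e] by (auto simp: wf_graph_def)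
  ultimately have "e \<in> edge_cut (avoiding S (edges \<Gamma>)) A"
    using a_end f_on_path(1) crossing(4) assms
    by (auto simp: doubleton_in_edge_cut_iff avoiding_def)
  then show "f \<in> (\<Union>e\<in>edge_cut (avoiding S (edges \<Gamma>)) A. path_edges (P e))"
    using f_on_path(2) by blast
qed

lemma finitely_separated_subdivision:
  assumes "finitely_separated (edges \<Gamma>) x y" "x \<in> verts \<Gamma>" "y \<in> verts \<Gamma>"
  shows "finitely_separated (edges G) x y"
proof -
  obtain A S where separator: "finite S" "x \<in> A" "y \<notin> A" "x \<notin> S" "y \<notin> S"
    and finite_cut: "finite (edge_cut (avoiding S (edges \<Gamma>)) A)"
    using assms(1) by (rule finitely_separatedE)
  define A' where "A' = A \<inter> verts \<Gamma> - S"
  have "edge_cut (avoiding S (edges \<Gamma>)) A' \<subseteq> edge_cut (avoiding S (edges \<Gamma>)) A"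
    using wf_\<Gamma> by (auto simp: edge_cut_def avoiding_def A'_def wf_graph_def)
  then have "finite (edge_cut (avoiding S (edges \<Gamma>)) A')"
    using finite_cut by (rule finite_subset)
  then have "finite (\<Union>e\<in>edge_cut (avoiding S (edges \<Gamma>)) A'. path_edges (P e))"
    using finite_path_edges by blast
  then have "finite (edge_cut (avoiding S (edges G)) (spread A'))"
    by (rule finite_subset[OF edge_cut_spread_subset, rotated]) (auto simp: A'_def)
  moreover have "x \<in> spread A'" "y \<notin> spread A'"
    using spread_Int_branch_verts[of A'] separator assms(2,3) by (auto simp: A'_def)
  ultimately show ?thesis
    using separator unfolding finitely_separated_def by blast
qed

lemma finite_degree_inner:
  assumes "e \<in> edges \<Gamma>" "w \<in> inner (P e)"
  shows "finite {f \<in> edges G. w \<in> f}"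
proof (rule finite_subset)
  show "{f \<in> edges G. w \<in> f} \<subseteq> path_edges (P e)"
    using assms path_unique_of_inner path_edges_subset_set by (fastforce simp: edges_eq)
qed (rule finite_path_edges)

lemma finitely_separated_inner:
  assumes "x \<in> verts G - verts \<Gamma>" "x \<noteq> y"
  shows "finitely_separated (edges G) x y"
proof -
  obtain e where "e \<in> edges \<Gamma>" "x \<in> inner (P e)"
    using assms(1) by (auto simp: verts_eq)
  then have "finite {f \<in> edges G. x \<in> f}"
    by (rule finite_degree_inner)
  then have "finite (edge_cut (edges G) {x})"
    by (rule rev_finite_subset) (auto simp: edge_cut_def)
  then show ?thesis
    using assms(2) unfolding finitely_separated_def
    by (intro exI[of _ "{x}"] exI[of _ "{}"]) (simp add: avoiding_def)
qed

lemma finitely_separable_iff: "finitely_separable G \<longleftrightarrow> finitely_separable \<Gamma>"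
proof
  assume "finitely_separable G"
  then show "finitely_separable \<Gamma>"
    using finitely_separated_branch_graph by (simp add: finitely_separable_def verts_eq)
next
  assume "finitely_separable \<Gamma>"
  then show "finitely_separable G"
    using finitely_separated_subdivision finitely_separated_inner finitely_separated_sym
    unfolding finitely_separable_def by (metis DiffI)
qed

end

lemma subdivision_ofE:
  assumes "subdivision_of G \<Gamma>"
  obtains P where "subdivision G \<Gamma> P"
proof -
  from assms obtain P where P:
    "\<forall>e\<in>edges \<Gamma>. gpath G (P e) \<and> {hd (P e), last (P e)} = e \<and> inner (P e) \<inter> verts \<Gamma> = {}"
    "\<forall>e\<in>edges \<Gamma>. \<forall>e'\<in>edges \<Gamma>. e \<noteq> e' \<longrightarrow> inner (P e) \<inter> inner (P e') = {}"
    "verts G = verts \<Gamma> \<union> (\<Union>e\<in>edges \<Gamma>. inner (P e))"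
    "edges G = (\<Union>e\<in>edges \<Gamma>. path_edges (P e))"
    unfolding subdivision_of_def by (elim conjE exE)
  have "subdivision G \<Gamma> P"
    by unfold_locales
      (use assms P in \<open>simp_all add: subdivision_of_def ends_def disjoint_family_on_def\<close>)
  then show thesis
    by (rule that)
qed

section \<open>Contractions\<close>

definition proj :: "'a set \<Rightarrow> 'a \<Rightarrow> 'a set" where
  "proj X w = (if w \<in> X then X else {w})"

lemma proj_eq_iff: "proj X a = proj X b \<longleftrightarrow> a = b \<or> a \<in> X \<and> b \<in> X"
  by (auto simp: proj_def)

lemma verts_contract: "verts (contract H X) = insert X (proj X ` verts H)"
  by (auto simp: contract_def proj_def)

lemma proj_image_in_edges_contract:
  assumes "{a, b} \<in> edges H" "b \<notin> X" "b \<in> verts H"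
  shows "proj X ` {a, b} \<in> edges (contract H X)"
  using assms
  by (cases "a \<in> X") (auto 0 2 simp: contract_def proj_def doubleton_eq_iff)

lemma edges_contract:
  assumes "wf_graph H"
  shows "edges (contract H X) = (`) (proj X) ` {e \<in> edges H. \<not> e \<subseteq> X}"
proof (intro equalityI subsetI)
  fix e' assume "e' \<in> edges (contract H X)"
  then consider (old) a b where "e' = {{a}, {b}}" "{a, b} \<in> edges H" "a \<notin> X" "b \<notin> X"
    | (new) x w where "e' = {X, {w}}" "{x, w} \<in> edges H" "x \<in> X" "w \<notin> X"
    by (auto simp: contract_def)
  then show "e' \<in> (`) (proj X) ` {e \<in> edges H. \<not> e \<subseteq> X}"
  proof cases
    case old
    then show ?thesis
      by (intro image_eqI[of _ _ "{a, b}"]) (auto simp: proj_def)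
  next
    case new
    then show ?thesis
      by (intro image_eqI[of _ _ "{x, w}"]) (auto simp: proj_def)
  qed
next
  fix e' assume "e' \<in> (`) (proj X) ` {e \<in> edges H. \<not> e \<subseteq> X}"
  then obtain e where e_image: "e \<in> edges H" "\<not> e \<subseteq> X" "e' = proj X ` e"
    by blast
  obtain a b where e_eq: "e = {a, b}" "a \<in> verts H" "b \<in> verts H"
    using assms e_image(1) by (rule wf_graph_edgeE)
  show "e' \<in> edges (contract H X)"
    using e_image e_eq proj_image_in_edges_contract[of a b H X]
      proj_image_in_edges_contract[of b a H X]
    by (cases "b \<in> X") (simp_all add: insert_commute)
qed

lemma wf_contract:
  assumes "wf_graph H"
  shows "wf_graph (contract H X)"
  unfolding wf_graph_def
proof
  fix e' assume "e' \<in> edges (contract H X)"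
  then obtain e where e_image: "e \<in> edges H" "\<not> e \<subseteq> X" "e' = proj X ` e"
    using edges_contract[OF assms] by auto
  obtain a b where e_eq: "e = {a, b}" "a \<noteq> b" "a \<in> verts H" "b \<in> verts H"
    using assms e_image(1) by (rule wf_graph_edgeE)
  then have "proj X a \<noteq> proj X b"
    using e_image(2) by (simp add: proj_eq_iff)
  then show "card e' = 2 \<and> e' \<subseteq> verts (contract H X)"
    using e_image(3) e_eq by (simp add: verts_contract)
qed

lemma edge_cut_contract_subset:
  assumes "wf_graph H" "X \<inter> A = {}" "X \<inter> S = {}"
  shows "edge_cut (avoiding (proj X ` S) (edges (contract H X))) (proj X ` A)
    \<subseteq> (`) (proj X) ` edge_cut (avoiding S (edges H)) A"
proof
  fix e' assume e'_cut: "e' \<in> edge_cut (avoiding (proj X ` S) (edges (contract H X))) (proj X ` A)"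
  then have "e' \<in> edges (contract H X)"
    by (auto simp: edge_cut_def avoiding_def)
  then obtain e where e_image: "e \<in> edges H" "e' = proj X ` e"
    unfolding edges_contract[OF assms(1)] by blast
  obtain c d where "e = {c, d}"
    using assms(1) e_image(1) by (rule wf_graph_edgeE)
  moreover have "proj X w \<in> proj X ` A \<longleftrightarrow> w \<in> A" "proj X w \<in> proj X ` S \<longleftrightarrow> w \<in> S" for w
    using assms(2,3) by (auto simp: proj_eq_iff)
  ultimately have "e \<in> edge_cut (avoiding S (edges H)) A"
    using e'_cut e_image by (simp add: doubleton_in_edge_cut_iff avoiding_def)
  then show "e' \<in> (`) (proj X) ` edge_cut (avoiding S (edges H)) A"
    using e_image(2) by blast
qed

text \<open>A separator of \<open>a\<close> from \<open>insert b X\<close> projects to one of \<open>{a}\<close> from \<open>{b}\<close> and from \<open>X\<close>.\<close>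

lemma finitely_separated_contract:
  assumes "wf_graph H" "finitely_separable H" "finite X" "X \<subseteq> verts H"
    and "a \<in> verts H - X" "b \<in> verts H" "a \<noteq> b"
  shows "finitely_separated (edges (contract H X)) (proj X a) (proj X b)"
proof -
  have "finitely_separated (edges H) a z" if "z \<in> insert b X" for z
  proof -
    have "z \<in> verts H" "a \<noteq> z"
      using that assms(4-7) by auto
    then show ?thesis
      using assms(2,5) by (simp add: finitely_separable_def)
  qed
  then obtain A S where separator: "finite S" "a \<in> A" "a \<notin> S" "insert b X \<inter> (A \<union> S) = {}"
    and finite_cut: "finite (edge_cut (avoiding S (edges H)) A)"
    using finitely_separated_finite_set[of "insert b X" "edges H" a] assms(3)
    by (metis finite_insert)
  then have disjoint: "X \<inter> A = {}" "X \<inter> S = {}"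
    by auto
  let ?S = "proj X ` S" and ?A = "proj X ` A"
  have "finite (edge_cut (avoiding ?S (edges (contract H X))) ?A)"
    using finite_cut
    by (intro finite_subset[OF edge_cut_contract_subset[OF assms(1) disjoint]]) simp
  moreover have "proj X a \<in> ?A" "proj X b \<notin> ?A" "proj X a \<notin> ?S" "proj X b \<notin> ?S"
    using separator assms(5) by (auto simp: proj_eq_iff)
  ultimately show ?thesis
    using separator(1) unfolding finitely_separated_def
    by (intro exI[of _ ?A] exI[of _ ?S]) simp
qed

lemma finitely_separable_contract:
  assumes "wf_graph H" "finitely_separable H" "finite X" "X \<subseteq> verts H" "X \<noteq> {}"
  shows "finitely_separable (contract H X)"
  unfolding finitely_separable_def
proof (intro ballI impI)
  fix p q assume vertices: "p \<in> verts (contract H X)" "q \<in> verts (contract H X)" "p \<noteq> q"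
  obtain x where "x \<in> X" "x \<in> verts H"
    using assms(4,5) by blast
  then have "X \<in> proj X ` verts H"
    by (intro image_eqI[of _ _ x]) (simp_all add: proj_def)
  then have "verts (contract H X) = proj X ` verts H"
    by (simp add: verts_contract insert_absorb)
  then obtain a b where p_eq: "a \<in> verts H" "p = proj X a" and q_eq: "b \<in> verts H" "q = proj X b"
    using vertices(1,2) by (metis imageE)
  then have "a \<noteq> b" "a \<notin> X \<or> b \<notin> X"
    using vertices(3) by (auto simp: proj_eq_iff)
  then show "finitely_separated (edges (contract H X)) p q"
    using finitely_separated_contract[OF assms(1-4), of a b] p_eq q_eq
      finitely_separated_sym[OF finitely_separated_contract[OF assms(1-4), of b a]] by auto
qed

lemma edge_inseparable_contract:
  assumes "wf_graph H" "finite X" "edge_inseparable (edges H) a b"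
  shows "edge_inseparable (edges (contract H X)) (proj X a) (proj X b)"
  unfolding edge_inseparable_def
proof (intro allI impI)
  fix A assume finite_cut: "finite (edge_cut (edges (contract H X)) A)"
  let ?C = "edge_cut (edges (contract H X)) A"
  have "edge_cut (edges H) (proj X -` A) \<subseteq> (\<Union>e'\<in>?C. Pow (\<Union>e'))"
  proof
    fix e assume "e \<in> edge_cut (edges H) (proj X -` A)"
    then obtain c d where crossing: "e = {c, d}" "proj X c \<in> A" "proj X d \<notin> A" "e \<in> edges H"
      by (auto simp: edge_cut_def)
    then have "proj X c \<noteq> proj X d"
      by auto
    then have "\<not> e \<subseteq> X"
      using crossing(1) by (simp add: proj_eq_iff)
    then have "proj X ` e \<in> edges (contract H X)"
      unfolding edges_contract[OF assms(1)] using crossing(4) by blast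
    then have "proj X ` e \<in> ?C"
      using crossing(1-3) by (simp add: doubleton_in_edge_cut_iff)
    moreover have "e \<in> Pow (\<Union>(proj X ` e))"
      by (auto simp: proj_def)
    ultimately show "e \<in> (\<Union>e'\<in>?C. Pow (\<Union>e'))"
      by blast
  qed
  moreover have "finite (\<Union>e')" if "e' \<in> ?C" for e'
    using that assms(2) by (auto simp: edge_cut_def contract_def)
  then have "finite (\<Union>e'\<in>?C. Pow (\<Union>e'))"
    using finite_cut by simp
  ultimately have "finite (edge_cut (edges H) (proj X -` A))"
    by (rule finite_subset)
  then show "proj X a \<in> A \<longleftrightarrow> proj X b \<in> A"
    using assms(3) unfolding edge_inseparable_def by (metis vimage_eq)
qed

definition uncontract :: "'a graph \<Rightarrow> 'a set \<Rightarrow> 'a set graph \<Rightarrow> 'a graph" where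
  "uncontract H X K = \<lparr>verts = X \<union> {w \<in> verts H. {w} \<in> verts K},
    edges = {e \<in> edges H. e \<subseteq> X \<or> proj X ` e \<in> edges K}\<rparr>"

lemma subgraph_uncontract:
  assumes "wf_graph H" "X \<subseteq> verts H" "wf_graph K"
  shows "subgraph (uncontract H X K) H"
proof -
  have "e \<subseteq> verts (uncontract H X K)" if edge: "e \<in> edges H" "proj X ` e \<in> edges K" for e
  proof
    fix w assume "w \<in> e"
    then have "proj X w \<in> verts K" "w \<in> verts H"
      using assms(1,3) edge unfolding wf_graph_def by blast+
    then show "w \<in> verts (uncontract H X K)"
      by (auto simp: uncontract_def proj_def split: if_splits)
  qed
  then show ?thesis
    using assms(1,2) by (auto simp: subgraph_def wf_graph_def uncontract_def)
qed

lemma induced_uncontract: "induced (uncontract H X K) X = induced H X"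
  by (auto simp: induced_def uncontract_def)

lemma contract_uncontract:
  assumes "wf_graph H" "X \<subseteq> verts H" "subgraph K (contract H X)" "X \<in> verts K"
  shows "contract (uncontract H X K) X = K"
proof -
  have "subgraph (uncontract H X K) H"
    using assms by (intro subgraph_uncontract) (simp_all add: subgraph_def)
  then have "edges (contract (uncontract H X K) X) =
      (`) (proj X) ` {e \<in> edges (uncontract H X K). \<not> e \<subseteq> X}"
    by (intro edges_contract) (simp add: subgraph_def)
  also have "\<dots> = (`) (proj X) ` {e \<in> edges H. \<not> e \<subseteq> X} \<inter> edges K"
    by (auto simp: uncontract_def)
  also have "\<dots> = edges K"
    using assms(3) unfolding edges_contract[OF assms(1), symmetric] by (auto simp: subgraph_def)
  finally have "edges (contract (uncontract H X K) X) = edges K" .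
  moreover have "verts (contract (uncontract H X K) X) = verts K"
    using assms(2-4) by (auto simp: uncontract_def contract_def subgraph_def)
  ultimately show ?thesis
    by simp
qed

section \<open>Linkages\<close>

definition linking_path :: "'a set \<Rightarrow> 'a set set \<Rightarrow> 'a list \<Rightarrow> bool" where
  "linking_path U E l \<longleftrightarrow>
    is_path E (hd l) (last l) l \<and> hd l \<noteq> last l \<and> ends l \<subseteq> U \<and> inner l \<inter> U = {}"

definition linkage :: "'a set \<Rightarrow> 'a set set \<Rightarrow> 'a list set \<Rightarrow> bool" where
  "linkage U E L \<longleftrightarrow>
    (\<forall>l\<in>L. linking_path U E l) \<and> disjoint_family_on inner L \<and> inj_on ends L"

lemma linking_path_mono: "linking_path U E l \<Longrightarrow> E \<subseteq> E' \<Longrightarrow> linking_path U E' l"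
  unfolding linking_path_def using is_path_mono by metis

lemma linkage_mono: "linkage U E L \<Longrightarrow> E \<subseteq> E' \<Longrightarrow> linkage U E' L"
  unfolding linkage_def using linking_path_mono by metis

lemma set_linking_path: "linking_path U E l \<Longrightarrow> set l = ends l \<union> inner l"
  unfolding linking_path_def is_path_def by (intro set_eq_ends_Un_inner) auto

lemma linkage_Un:
  assumes "linkage U E K" "linkage U E L"
    and "\<And>k l. k \<in> K \<Longrightarrow> l \<in> L \<Longrightarrow> inner k \<inter> inner l = {} \<and> ends k \<noteq> ends l"
  shows "linkage U E (K \<union> L)"
  unfolding linkage_def
proof (intro conjI)
  show "\<forall>l\<in>K \<union> L. linking_path U E l"
    using assms(1,2) by (auto simp: linkage_def)
  show "disjoint_family_on inner (K \<union> L)"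
    using assms unfolding linkage_def disjoint_family_on_def by (metis Int_commute UnE)
  show "inj_on ends (K \<union> L)"
    using assms by (auto simp: linkage_def inj_on_Un)
qed

lemma linkage_insert:
  assumes "linking_path U E k" "linkage U E L"
    and "\<And>l. l \<in> L \<Longrightarrow> inner k \<inter> inner l = {} \<and> ends k \<noteq> ends l"
  shows "linkage U E (insert k L)"
proof -
  have "linkage U E {k}"
    using assms(1) by (simp add: linkage_def disjoint_family_on_def)
  then show ?thesis
    using linkage_Un[of U E "{k}" L] assms(2,3) by simp
qed

lemma linkage_Union_chain:
  fixes L :: "nat \<Rightarrow> 'a list set"
  assumes "mono L" "\<And>n. linkage U E (L n)"
  shows "linkage U E (\<Union>n. L n)"
proof -
  have common: "\<exists>n. k \<in> L n \<and> l \<in> L n" if in_Union: "k \<in> (\<Union>n. L n)" "l \<in> (\<Union>n. L n)" for k l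
  proof -
    obtain m n where "k \<in> L m" "l \<in> L n"
      using in_Union by blast
    then have "k \<in> L (max m n)" "l \<in> L (max m n)"
      using monoD[OF assms(1), of m "max m n"] monoD[OF assms(1), of n "max m n"] by auto
    then show ?thesis
      by blast
  qed
  show ?thesis
    unfolding linkage_def disjoint_family_on_def inj_on_def
  proof (intro conjI ballI impI)
    fix k l assume "k \<in> (\<Union>n. L n)" "l \<in> (\<Union>n. L n)"
    then obtain n where in_stage: "k \<in> L n" "l \<in> L n"
      using common by blast
    show "inner k \<inter> inner l = {}" if "k \<noteq> l"
      using assms(2)[of n] in_stage that by (auto simp: linkage_def disjoint_family_on_def)
    show "k = l" if "ends k = ends l"
      using assms(2)[of n] in_stage that by (auto simp: linkage_def inj_on_def)
  qed (use assms(2) in \<open>auto simp: linkage_def\<close>)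
qed

lemma first_linking_pathE:
  assumes "is_path E a b p" "a \<in> U" "b \<in> U" "a \<noteq> b"
  obtains m c q where "p = a # m @ c # q" "linking_path U E (a # m @ [c])" "c \<in> U"
    "is_path E c b (c # q)"
proof -
  obtain r where "p = a # r @ [b]"
    using assms(1,4) by (rule is_path_ConsE)
  moreover obtain m c q where "r @ [b] = m @ c # q" and "c \<in> U" and m_outside: "\<forall>d\<in>set m. d \<notin> U"
    using split_list_first_prop[of "r @ [b]" "\<lambda>c. c \<in> U"] assms(3) by auto
  ultimately have p_eq: "p = a # m @ c # q"
    by simp
  have edges_p: "path_edges p = path_edges (a # m @ [c]) \<union> path_edges (c # q)"
    using path_edges_append[of "a # m" c q] by (simp add: p_eq)
  have "linking_path U E (a # m @ [c])"
    using assms(1,2) \<open>c \<in> U\<close> m_outside edges_p p_eq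
    by (auto simp: linking_path_def is_path_def)
  moreover have "is_path E c b (c # q)"
    using assms(1) edges_p p_eq by (auto simp: is_path_def)
  ultimately show thesis
    using that p_eq \<open>c \<in> U\<close> by blast
qed

lemma linkage_insert_first:
  assumes "linking_path U E (a # m @ [c])" "linkage U E L" "distinct (a # m @ c # q)"
    and "\<And>l. l \<in> L \<Longrightarrow> set l \<subseteq> set (c # q)"
  shows "linkage U E (insert (a # m @ [c]) L)"
  using assms(1,2)
proof (rule linkage_insert)
  fix l assume "l \<in> L"
  then have "set l = ends l \<union> inner l"
    using assms(2) set_linking_path by (auto simp: linkage_def)
  moreover have "a \<notin> set (c # q)" "set m \<inter> set (c # q) = {}"
    using assms(3) by auto
  ultimately show "inner (a # m @ [c]) \<inter> inner l = {} \<and> ends (a # m @ [c]) \<noteq> ends l"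
    using assms(4)[OF \<open>l \<in> L\<close>] by auto
qed

lemma ex_linkage_of_path:
  assumes "is_path E a b p" "a \<in> U" "b \<in> U"
  shows "\<exists>L. finite L \<and> linkage U E L \<and> (\<forall>l\<in>L. set l \<subseteq> set p) \<and> (a, b) \<in> reach (ends ` L)"
  using assms
proof (induction "length p" arbitrary: a p rule: less_induct)
  case less
  show ?case
  proof (cases "a = b")
    case True
    then show ?thesis
      by (intro exI[of _ "{}"]) (simp add: linkage_def disjoint_family_on_def reach_def)
  next
    case False
    with less.prems obtain m c q where p_eq: "p = a # m @ c # q"
      and first: "linking_path U E (a # m @ [c])" and rest: "is_path E c b (c # q)" and "c \<in> U"
      by (rule first_linking_pathE)
    have "length (c # q) < length p"
      by (simp add: p_eq)
    then obtain L where "finite L" and linkage_L: "linkage U E L"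
      and L_subset: "\<And>l. l \<in> L \<Longrightarrow> set l \<subseteq> set (c # q)" and reach_L: "(c, b) \<in> reach (ends ` L)"
      using less.hyps[OF _ rest \<open>c \<in> U\<close> less.prems(3)] by blast
    let ?L = "insert (a # m @ [c]) L"
    have "linkage U E ?L"
      using first linkage_L less.prems(1) L_subset p_eq
      by (intro linkage_insert_first[where q = q]) (simp_all add: is_path_def)
    moreover have "(c, b) \<in> reach (ends ` ?L)"
      using reach_L by (rule reach_mono) blast
    then have "(a, b) \<in> reach (ends ` ?L)"
      by (rule reach_step[rotated]) simp
    moreover have "\<forall>l\<in>?L. set l \<subseteq> set p"
      using L_subset by (auto simp: p_eq)
    ultimately show ?thesis
      using \<open>finite L\<close> by (intro exI[of _ ?L]) simp
  qed
qed

definition branch_graph :: "'a list set \<Rightarrow> 'a graph" where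
  "branch_graph L = \<lparr>verts = \<Union>(ends ` L), edges = ends ` L\<rparr>"

definition union_graph :: "'a list set \<Rightarrow> 'a graph" where
  "union_graph L = \<lparr>verts = (\<Union>l\<in>L. set l), edges = (\<Union>l\<in>L. path_edges l)\<rparr>"

lemma subdivision_linkage:
  assumes "linkage U E L"
  shows "subdivision (union_graph L) (branch_graph L) (inv_into L ends)"
proof
  have inv_ends [simp]: "inv_into L ends (ends l) = l" if "l \<in> L" for l
    using assms that by (simp add: linkage_def)
  have linking: "is_path E (hd l) (last l) l" "hd l \<noteq> last l" "ends l \<subseteq> U" "inner l \<inter> U = {}"
    "set l = ends l \<union> inner l" if "l \<in> L" for l
    using assms that set_linking_path[of U E l] by (auto simp: linkage_def linking_path_def)
  show "wf_graph (branch_graph L)"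
    using linking(2) by (auto simp: wf_graph_def branch_graph_def ends_def)
  show "verts (union_graph L) =
      verts (branch_graph L) \<union> (\<Union>e\<in>edges (branch_graph L). inner (inv_into L ends e))"
    using linking(5) by (auto simp: union_graph_def branch_graph_def)
  show "edges (union_graph L) = (\<Union>e\<in>edges (branch_graph L). path_edges (inv_into L ends e))"
    by (auto simp: union_graph_def branch_graph_def)
  show "disjoint_family_on (\<lambda>e. inner (inv_into L ends e)) (edges (branch_graph L))"
    using assms by (fastforce simp: branch_graph_def linkage_def disjoint_family_on_def)
  fix e assume "e \<in> edges (branch_graph L)"
  then obtain l where e_eq: "l \<in> L" "e = ends l"
    by (auto simp: branch_graph_def)
  then show "gpath (union_graph L) (inv_into L ends e)" "ends (inv_into L ends e) = e"
    using linking(1)[OF e_eq(1)] by (auto simp: gpath_iff is_path_def union_graph_def)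
  show "inner (inv_into L ends e) \<inter> verts (branch_graph L) = {}"
    using e_eq linking(3,4) by (auto simp: branch_graph_def)
qed

lemma subgraph_union_graph:
  assumes "wf_graph H" "U \<subseteq> verts H" "linkage U (edges H) L"
  shows "subgraph (union_graph L) H"
proof -
  have "wf_graph (union_graph L)"
    using subdivision_linkage[OF assms(3)] by (rule subdivision.wf_G)
  moreover have "gpath H l" if "l \<in> L" for l
  proof -
    have "is_path (edges H) (hd l) (last l) l" "hd l \<in> verts H"
      using assms(2,3) that by (auto simp: linkage_def linking_path_def ends_def)
    then show ?thesis
      using gpath_iff_is_path[OF assms(1)] by blast
  qed
  ultimately show ?thesis
    by (auto simp: subgraph_def union_graph_def gpath_iff)
qed

section \<open>Subdivided \<Pi>-graphs on an edge-connectivity class\<close>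

definition edge_class :: "'a set set \<Rightarrow> 'a \<Rightarrow> 'a set" where
  "edge_class E x = {y. edge_inseparable E x y}"

lemma self_in_edge_class: "x \<in> edge_class E x"
  by (simp add: edge_class_def edge_inseparable_refl)

lemma edge_class_subset_verts:
  assumes "wf_graph H" "x \<in> verts H"
  shows "edge_class (edges H) x \<subseteq> verts H"
proof
  fix y assume "y \<in> edge_class (edges H) x"
  moreover have "edge_cut (edges H) (verts H) = {}"
    using assms(1) by (auto simp: edge_cut_def wf_graph_def)
  ultimately show "y \<in> verts H"
    using assms(2) by (auto simp: edge_class_def edge_inseparable_def)
qed

lemma ex_finite_edges_cutting_off:
  assumes "finite W" "W \<inter> edge_class E x = {}"
  obtains F where "finite F"
    "\<And>p. path_edges p \<subseteq> E - F \<Longrightarrow> set p \<inter> edge_class E x \<noteq> {} \<Longrightarrow> set p \<inter> W = {}"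
proof -
  obtain F where finite_F: "\<And>w. finite (F w)"
    and blocking: "\<And>w p y. path_edges p \<subseteq> E - F w \<Longrightarrow> y \<in> set p \<Longrightarrow> w \<in> set p \<Longrightarrow>
      y \<in> edge_class E x \<Longrightarrow> w \<in> edge_class E x"
    using ex_finite_edges_blocking_paths[of E _ x] unfolding edge_class_def mem_Collect_eq
    by metis
  have "set p \<inter> W = {}"
    if "path_edges p \<subseteq> E - (\<Union>w\<in>W. F w)" "set p \<inter> edge_class E x \<noteq> {}" for p
  proof (rule ccontr)
    assume "set p \<inter> W \<noteq> {}"
    then obtain w where "w \<in> set p" "w \<in> W"
      by blast
    moreover from this have "path_edges p \<subseteq> E - F w"
      using that(1) by blast
    ultimately show False
      using blocking that(2) assms(2) by blast
  qed
  moreover have "finite (\<Union>w\<in>W. F w)"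
    using assms(1) finite_F by simp
  ultimately show thesis
    using that by blast
qed

locale separable_edge_class =
  fixes E :: "'a set set" and x :: 'a
  assumes separated:
    "a \<in> edge_class E x \<Longrightarrow> b \<in> edge_class E x \<Longrightarrow> a \<noteq> b \<Longrightarrow> finitely_separated E a b"
begin

abbreviation U :: "'a set" where
  "U \<equiv> edge_class E x"

lemma ex_finite_edges_blocking_ends:
  assumes "a \<in> U" "b \<in> U" "a \<noteq> b"
  shows "\<exists>F. finite F \<and> (\<forall>l. linking_path U (E - F) l \<longrightarrow> ends l \<noteq> {a, b})"
proof -
  obtain A S where separator: "finite S" "a \<in> A" "b \<notin> A" "a \<notin> S" "b \<notin> S"
    and finite_cut: "finite (edge_cut (avoiding S E) A)"
    using separated[OF assms] by (rule finitely_separatedE)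
  obtain F where "finite F"
    and cut_off: "\<And>p. path_edges p \<subseteq> E - F \<Longrightarrow> set p \<inter> U \<noteq> {} \<Longrightarrow> set p \<inter> (S - U) = {}"
    using ex_finite_edges_cutting_off[of "S - U" E x] separator(1) by blast
  let ?F = "F \<union> edge_cut (avoiding S E) A"
  have "ends l \<noteq> {a, b}" if linking: "linking_path U (E - ?F) l" for l
  proof
    assume "ends l = {a, b}"
    then have set_l: "set l = {a, b} \<union> inner l" and "inner l \<inter> U = {}"
      using set_linking_path[OF linking] linking by (simp_all add: linking_path_def)
    have edges_l: "path_edges l \<subseteq> E - ?F"
      using linking by (simp add: linking_path_def is_path_def)
    then have "path_edges l \<subseteq> E - F"
      by blast
    moreover have "set l \<inter> U \<noteq> {}"
      unfolding set_l using assms(1) by blast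
    ultimately have "set l \<inter> (S - U) = {}"
      by (rule cut_off)
    then have "set l \<inter> S = {}"
      unfolding set_l using \<open>inner l \<inter> U = {}\<close> separator(4,5) by blast
    then have "path_edges l \<inter> edge_cut (avoiding S E) A \<noteq> {}"
      using edges_l set_l separator(2,3) by (intro path_edges_meet_separator[of l E S a b]) auto
    then show False
      using edges_l by blast
  qed
  then show ?thesis
    using \<open>finite F\<close> finite_cut by (intro exI[of _ ?F]) simp
qed

lemma ex_finite_edges_blocking_linkage:
  assumes "finite L" "linkage U E L"
  obtains F where "finite F"
    "\<And>k l. linking_path U (E - F) k \<Longrightarrow> l \<in> L \<Longrightarrow> inner k \<inter> inner l = {} \<and> ends k \<noteq> ends l"
proof -
  have linking: "linking_path U E l" if "l \<in> L" for l
    using assms(2) that by (simp add: linkage_def)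
  have "\<exists>F. finite F \<and> (\<forall>k. linking_path U (E - F) k \<longrightarrow> ends k \<noteq> ends l)" if "l \<in> L" for l
    using linking[OF that] ex_finite_edges_blocking_ends[of "hd l" "last l"]
    by (auto simp: linking_path_def ends_def)
  then obtain F\<^sub>e where finite_F\<^sub>e: "\<And>l. l \<in> L \<Longrightarrow> finite (F\<^sub>e l)"
    and new_ends: "\<And>l k. l \<in> L \<Longrightarrow> linking_path U (E - F\<^sub>e l) k \<Longrightarrow> ends k \<noteq> ends l"
    by metis
  let ?W = "\<Union>l\<in>L. inner l"
  have "finite ?W" "?W \<inter> U = {}"
    using assms(1) linking by (auto simp: inner_def linking_path_def)
  then obtain F\<^sub>i where "finite F\<^sub>i"
    and new_inner: "\<And>p. path_edges p \<subseteq> E - F\<^sub>i \<Longrightarrow> set p \<inter> U \<noteq> {} \<Longrightarrow> set p \<inter> ?W = {}"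
    by (rule ex_finite_edges_cutting_off) blast
  let ?F = "F\<^sub>i \<union> (\<Union>l\<in>L. F\<^sub>e l)"
  show thesis
  proof (rule that)
    show "finite ?F"
      using \<open>finite F\<^sub>i\<close> finite_F\<^sub>e assms(1) by simp
    fix k l assume linking_k: "linking_path U (E - ?F) k" and "l \<in> L"
    have "path_edges k \<subseteq> E - F\<^sub>i" "set k \<inter> U \<noteq> {}"
      using linking_k set_linking_path[OF linking_k]
      by (auto simp: linking_path_def is_path_def ends_def)
    then have "inner k \<inter> inner l = {}"
      using new_inner[of k] set_linking_path[OF linking_k] \<open>l \<in> L\<close> by blast
    moreover have "linking_path U (E - F\<^sub>e l) k"
      using linking_k by (rule linking_path_mono) (use \<open>l \<in> L\<close> in blast)
    ultimately show "inner k \<inter> inner l = {} \<and> ends k \<noteq> ends l"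
      using new_ends[OF \<open>l \<in> L\<close>] by blast
  qed
qed

lemma extend_linkage_to_vertex:
  assumes "finite L" "linkage U E L" "a \<in> U"
  shows "\<exists>K. finite K \<and> linkage U E (L \<union> K) \<and> ends ` L \<inter> ends ` K = {} \<and>
    (x, a) \<in> reach (ends ` K)"
proof -
  obtain F where "finite F" and new: "\<And>k l. linking_path U (E - F) k \<Longrightarrow> l \<in> L \<Longrightarrow>
      inner k \<inter> inner l = {} \<and> ends k \<noteq> ends l"
    using ex_finite_edges_blocking_linkage[OF assms(1,2)] by blast
  obtain p where "is_path (E - F) x a p"
    using ex_path_if_edge_inseparable[OF _ \<open>finite F\<close>, of E x a] assms(3)
    by (auto simp: edge_class_def)
  then obtain K where new_paths: "finite K" "linkage U (E - F) K" "(x, a) \<in> reach (ends ` K)"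
    using ex_linkage_of_path[of "E - F" x a p U] self_in_edge_class assms(3) by metis
  have disjoint: "inner k \<inter> inner l = {} \<and> ends k \<noteq> ends l" if "k \<in> K" "l \<in> L" for k l
    using new new_paths(2) that by (simp add: linkage_def)
  have "linkage U E (K \<union> L)"
    using linkage_mono[OF new_paths(2)] assms(2) disjoint by (intro linkage_Un) auto
  moreover have "ends ` L \<inter> ends ` K = {}"
    using disjoint by force
  ultimately show ?thesis
    using new_paths(1,3) by (auto simp: Un_commute)
qed

lemma extend_linkage:
  assumes "finite L" "linkage U E L" "finite A" "A \<subseteq> U"
  shows "\<exists>L'. finite L' \<and> linkage U E L' \<and> L \<subseteq> L' \<and>
    (\<forall>a\<in>A. (x, a) \<in> reach (ends ` L' - ends ` L))"
  using assms(3,4)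
proof (induction A rule: finite_induct)
  case empty
  then show ?case
    using assms(1,2) by blast
next
  case (insert a A)
  then obtain L' where extended: "finite L'" "linkage U E L'" "L \<subseteq> L'"
    and reach_A: "\<And>b. b \<in> A \<Longrightarrow> (x, b) \<in> reach (ends ` L' - ends ` L)"
    by auto
  obtain K where new_paths: "finite K" "linkage U E (L' \<union> K)" "ends ` L' \<inter> ends ` K = {}"
    and reach_a: "(x, a) \<in> reach (ends ` K)"
    using extend_linkage_to_vertex[OF extended(1,2), of a] insert.prems by auto
  have "(x, a) \<in> reach (ends ` (L' \<union> K) - ends ` L)"
    using reach_a by (rule reach_mono) (use new_paths(3) extended(3) in blast)
  moreover have "(x, b) \<in> reach (ends ` (L' \<union> K) - ends ` L)" if "b \<in> A" for b
    using reach_A[OF that] by (rule reach_mono) blast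
  ultimately show ?case
    using extended(1,3) new_paths(1,2) by (intro exI[of _ "L' \<union> K"]) auto
qed

lemma ex_linkage_chain:
  assumes "linking_path U E l"
  shows "\<exists>L :: nat \<Rightarrow> 'a list set. \<forall>n. (finite (L n) \<and> linkage U E (L n) \<and> l \<in> L n) \<and>
    (L n \<subseteq> L (Suc n) \<and> (\<forall>a\<in>\<Union>(ends ` L n). (x, a) \<in> reach (ends ` L (Suc n) - ends ` L n)))"
proof (rule dependent_nat_choice)
  show "\<exists>L. finite L \<and> linkage U E L \<and> l \<in> L"
    using assms by (intro exI[of _ "{l}"]) (simp add: linkage_def disjoint_family_on_def)
next
  fix L and n :: nat
  assume linkage: "finite L \<and> linkage U E L \<and> l \<in> L"
  then have "finite (\<Union>(ends ` L))" "\<Union>(ends ` L) \<subseteq> U"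
    by (auto simp: ends_def linkage_def linking_path_def)
  then obtain L' where "finite L'" "linkage U E L'" "L \<subseteq> L'"
    "\<forall>a\<in>\<Union>(ends ` L). (x, a) \<in> reach (ends ` L' - ends ` L)"
    using extend_linkage[of L "\<Union>(ends ` L)"] linkage by blast
  then show "\<exists>L'. (finite L' \<and> linkage U E L' \<and> l \<in> L') \<and>
    (L \<subseteq> L' \<and> (\<forall>a\<in>\<Union>(ends ` L). (x, a) \<in> reach (ends ` L' - ends ` L)))"
    using linkage by (intro exI[of _ L']) auto
qed

lemma ex_inseparable_linkage:
  assumes "linking_path U E l"
  obtains L where "linkage U E L" "l \<in> L"
    "\<And>a. a \<in> \<Union>(ends ` L) \<Longrightarrow> edge_inseparable (ends ` L) x a"
proof -
  obtain L :: "nat \<Rightarrow> 'a list set" where linkage: "\<And>n. linkage U E (L n)" and "\<And>n. l \<in> L n"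
    and Suc: "\<And>n. L n \<subseteq> L (Suc n)"
    and reach_new: "\<And>n a. a \<in> \<Union>(ends ` L n) \<Longrightarrow> (x, a) \<in> reach (ends ` L (Suc n) - ends ` L n)"
    using ex_linkage_chain[OF assms] by metis
  have "mono L"
    unfolding mono_iff_le_Suc by (intro allI Suc)
  let ?new = "\<lambda>n. ends ` L (Suc n) - ends ` L n"
  have "disjoint_family ?new"
    using Suc by (intro disjoint_family_Suc image_mono)
  have "edge_inseparable (ends ` (\<Union>n. L n)) x a" if a_end: "a \<in> \<Union>(ends ` (\<Union>n. L n))" for a
  proof -
    obtain m where a_in_stage: "a \<in> \<Union>(ends ` L m)"
      using a_end by blast
    show ?thesis
    proof (rule edge_inseparable_if_infinitely_reach)
      show "disjoint_family_on ?new {m..}"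
        using \<open>disjoint_family ?new\<close> by (rule disjoint_family_on_mono[rotated]) simp
      show "(x, a) \<in> reach (?new n)" if "n \<in> {m..}" for n
        using that a_in_stage \<open>mono L\<close> by (intro reach_new) (auto dest: monoD)
    qed (auto simp: infinite_Ici)
  qed
  moreover have "linkage U E (\<Union>n. L n)"
    using \<open>mono L\<close> linkage by (rule linkage_Union_chain)
  ultimately show thesis
    using that[of "\<Union>n. L n"] \<open>\<And>n. l \<in> L n\<close> by blast
qed

end

lemma ex_subdivided_pi_subgraph:
  assumes "wf_graph H" "finitely_separable H"
    and "edge_inseparable (edges H) x y" "{x, y} \<in> edges H" "x \<noteq> y"
  obtains K B where "subgraph K H" "subdivided_pi K B" "x \<in> B" "y \<in> B" "{x, y} \<in> edges K"
proof -
  let ?U = "edge_class (edges H) x"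
  have "x \<in> verts H"
    using assms(1,4) by (auto simp: wf_graph_def)
  with assms(1) have U_verts: "?U \<subseteq> verts H"
    by (rule edge_class_subset_verts)
  interpret separable_edge_class "edges H" x
    by unfold_locales (use assms(2) U_verts in \<open>auto simp: finitely_separable_def\<close>)
  have "linking_path ?U (edges H) [x, y]"
    using assms(3-5) self_in_edge_class
    by (auto simp: linking_path_def is_path_def ends_def inner_def edge_class_def)
  then obtain L where linkage: "linkage ?U (edges H) L" and "[x, y] \<in> L"
    and inseparable: "\<And>a. a \<in> \<Union>(ends ` L) \<Longrightarrow> edge_inseparable (ends ` L) x a"
    using ex_inseparable_linkage by blast
  interpret subdivision "union_graph L" "branch_graph L" "inv_into L ends"
    using linkage by (rule subdivision_linkage)
  have sub: "subgraph (union_graph L) H"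
    using assms(1) U_verts linkage by (rule subgraph_union_graph)
  have xy_in: "x \<in> verts (branch_graph L)" "y \<in> verts (branch_graph L)"
    "{x, y} \<in> edges (union_graph L)"
    using \<open>[x, y] \<in> L\<close> by (force simp: branch_graph_def union_graph_def ends_def)+
  have "inf_edge_connected (branch_graph L)"
    unfolding inf_edge_connected_iff using xy_in(1,2) assms(5) inseparable
    by (auto simp: branch_graph_def edge_inseparable_def)
  moreover have "finitely_separable (branch_graph L)"
    using finitely_separable_iff finitely_separable_subgraph[OF assms(2) sub] by simp
  ultimately have "pi_graph (branch_graph L)"
    using wf_\<Gamma> by (simp add: pi_graph_iff)
  then have "subdivided_pi (union_graph L) (verts (branch_graph L))"
    using subdivision_of by (auto simp: subdivided_pi_def)
  then show thesis
    using that sub xy_in by blast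
qed

section \<open>Splitting along a path\<close>

definition pi_side :: "'a graph \<Rightarrow> 'a set \<Rightarrow> 'a \<Rightarrow> 'a graph \<Rightarrow> bool" where
  "pi_side G X w H \<longleftrightarrow> subgraph H G \<and> X \<subseteq> verts H \<and> induced H X = induced G X \<and>
    (\<exists>B. subdivided_pi (contract H X) B \<and> {w} \<in> B \<and> X \<in> B) \<and> {{w}, X} \<in> edges (contract H X)"

lemma ex_pi_side:
  assumes "wf_graph H" "finitely_separable H" "finite X" "X \<subseteq> verts H" "w \<notin> X"
    and "t \<in> X" "{t, w} \<in> edges H" "s \<in> X" "edge_inseparable (edges H) w s"
  shows "\<exists>H'. pi_side H X w H'"
proof -
  have proj: "proj X w = {w}" "proj X t = X" "proj X s = X"
    using assms(5,6,8) by (simp_all add: proj_def)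
  have "edge_inseparable (edges (contract H X)) {w} X"
    using edge_inseparable_contract[OF assms(1,3,9)] by (simp add: proj)
  moreover have "proj X ` {t, w} \<in> edges (contract H X)"
    unfolding edges_contract[OF assms(1)] using assms(5,7) by blast
  then have "{{w}, X} \<in> edges (contract H X)"
    by (simp add: proj insert_commute)
  moreover have "finitely_separable (contract H X)"
    using assms(1-4,6) by (intro finitely_separable_contract) auto
  moreover have "{w} \<noteq> X"
    using assms(5) by blast
  ultimately obtain K B where pi_subgraph: "subgraph K (contract H X)" "subdivided_pi K B"
    "{w} \<in> B" "X \<in> B" "{{w}, X} \<in> edges K"
    using ex_subdivided_pi_subgraph[OF wf_contract[OF assms(1)]] by metis
  then have "wf_graph K" "X \<in> verts K"
    by (auto simp: subgraph_def wf_graph_def)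
  then have "contract (uncontract H X K) X = K"
    using assms(1,4) pi_subgraph(1) by (intro contract_uncontract)
  moreover have "subgraph (uncontract H X K) H"
    using assms(1,4) \<open>wf_graph K\<close> by (rule subgraph_uncontract)
  moreover have "X \<subseteq> verts (uncontract H X K)"
    by (simp add: uncontract_def)
  ultimately have "pi_side H X w (uncontract H X K)"
    using pi_subgraph(2-5) by (auto simp: pi_side_def induced_uncontract)
  then show ?thesis
    by blast
qed

lemma wf_induced: "wf_graph G \<Longrightarrow> wf_graph (induced G Y)"
  by (auto simp: wf_graph_def induced_def)

lemma subgraph_induced: "wf_graph G \<Longrightarrow> Y \<subseteq> verts G \<Longrightarrow> subgraph (induced G Y) G"
  by (simp add: subgraph_def wf_induced) (simp add: induced_def)

lemma pi_side_induced:
  assumes "pi_side (induced G Y) X w H" "wf_graph G" "X \<subseteq> Y" "Y \<subseteq> verts G"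
  shows "pi_side G X w H" "verts H \<subseteq> Y"
proof -
  have "induced (induced G Y) X = induced G X"
    using assms(3) by (auto simp: induced_def)
  then show "pi_side G X w H" "verts H \<subseteq> Y"
    using assms subgraph_induced[OF assms(2,4)] by (auto simp: pi_side_def subgraph_def induced_def)
qed

definition inside :: "'a set \<Rightarrow> 'a set set \<Rightarrow> 'a set set" where
  "inside A E = {e \<in> E. e \<subseteq> A}"

lemma ex_pi_side_along_path:
  assumes "wf_graph G" "finitely_separable G" "is_path (edges G) u v p" "u \<noteq> v" "u \<in> A"
    and "s \<in> inner p" "edge_inseparable (inside (insert s A) (edges G)) u s"
  obtains H where "pi_side G (inner p) u H" "verts H \<subseteq> A \<union> inner p"
proof -
  obtain m where p_eq: "p = u # m @ [v]"
    using assms(3,4) by (rule is_path_ConsE)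
  then have inner_p: "inner p = set m"
    by simp
  then obtain t r where m_eq: "m = t # r"
    using assms(6) by (cases m) auto
  define Y where "Y = (A \<union> inner p) \<inter> verts G"
  have "set p \<subseteq> verts G"
    using assms(1,3) set_eq_Union_path_edges[of p] p_eq m_eq
    by (auto simp: is_path_def wf_graph_def)
  then have Y_bounds: "inner p \<subseteq> Y" "Y \<subseteq> verts G" "u \<in> Y"
    using assms(5) p_eq inner_p by (auto simp: Y_def)
  have "\<exists>H. pi_side (induced G Y) (inner p) u H"
  proof (rule ex_pi_side)
    show "wf_graph (induced G Y)"
      using assms(1) by (rule wf_induced)
    show "finitely_separable (induced G Y)"
      using assms(2) subgraph_induced[OF assms(1) Y_bounds(2)] by (rule finitely_separable_subgraph)
    show "u \<notin> inner p"
      using assms(3) p_eq inner_p by (simp add: is_path_def)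
    show "t \<in> inner p" "{t, u} \<in> edges (induced G Y)"
      using assms(3) Y_bounds p_eq m_eq inner_p
      by (auto simp: induced_def is_path_def insert_commute)
    show "edge_inseparable (edges (induced G Y)) u s"
      using assms(7) by (rule edge_inseparable_mono)
        (use assms(1,6) in \<open>auto simp: inside_def induced_def Y_def wf_graph_def\<close>)
  qed (use assms(6) Y_bounds(1) inner_p in \<open>simp_all add: induced_def\<close>)
  then obtain H where "pi_side (induced G Y) (inner p) u H"
    by blast
  from pi_side_induced[OF this assms(1) Y_bounds(1,2)] show thesis
    using that by (auto simp: Y_def)
qed

lemma initial_segment_within_side:
  assumes "is_path (E - edge_cut (avoiding S E) A) u v p" "u \<in> A" "u \<notin> S" "set p \<inter> S \<noteq> {}"
  obtains q s where "s \<in> S \<inter> set p" "u \<in> set q" "s \<in> set q"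
    "path_edges q \<subseteq> path_edges p" "\<Union>(path_edges q) \<subseteq> insert s A"
proof -
  have "\<exists>s\<in>set p. s \<in> S"
    using assms(4) by blast
  then obtain m s r where p_eq: "p = m @ s # r" and "s \<in> S" and m_S: "\<forall>w\<in>set m. w \<notin> S"
    using split_list_first_prop[of p "\<lambda>s. s \<in> S"] by blast
  then have "m \<noteq> []" "u \<in> set m"
    using assms(1,3) by (cases m; auto simp: is_path_def)+
  have edges_ms: "path_edges (m @ [s]) \<subseteq> path_edges p"
    using path_edges_append[of m s r] p_eq by simp
  then have edges_m: "path_edges m \<subseteq> E - edge_cut (avoiding S E) A"
    using path_edges_snoc[OF \<open>m \<noteq> []\<close>] assms(1) by (auto simp: is_path_def)
  have "set m \<subseteq> A"
  proof
    fix w assume "w \<in> set m"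
    then show "w \<in> A"
      using path_edges_meet_separator[of m E S u w A] \<open>u \<in> set m\<close> assms(2) edges_m m_S by auto
  qed
  moreover have "\<Union>(path_edges (m @ [s])) \<subseteq> set (m @ [s])"
    using path_edges_subset_set by blast
  ultimately have "\<Union>(path_edges (m @ [s])) \<subseteq> insert s A"
    by auto
  then show thesis
    using that[of s "m @ [s]"] edges_ms p_eq \<open>s \<in> S\<close> \<open>u \<in> set m\<close> by simp
qed

lemma ex_finite_edges_forcing_inseparable_hit:
  assumes "finite S" "u \<in> A" "u \<notin> S" "finite (edge_cut (avoiding S E) A)"
  shows "\<exists>F. finite F \<and> (\<forall>v p. is_path (E - F) u v p \<longrightarrow> set p \<inter> S \<noteq> {} \<longrightarrow>
    (\<exists>s\<in>S \<inter> set p. edge_inseparable (inside (insert s A) E) u s))"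
proof -
  have "\<exists>F. finite F \<and> (\<forall>q. path_edges q \<subseteq> inside (insert s A) E - F \<longrightarrow> u \<in> set q \<longrightarrow>
      s \<in> set q \<longrightarrow> edge_inseparable (inside (insert s A) E) u s)" for s
    using ex_finite_edges_blocking_paths[of "inside (insert s A) E" s u] edge_inseparable_refl
    by meson
  then obtain F where finite_F: "\<And>s. finite (F s)" and blocking: "\<And>s q.
      path_edges q \<subseteq> inside (insert s A) E - F s \<Longrightarrow> u \<in> set q \<Longrightarrow> s \<in> set q \<Longrightarrow>
      edge_inseparable (inside (insert s A) E) u s"
    by metis
  let ?F = "edge_cut (avoiding S E) A \<union> (\<Union>s\<in>S. F s)"
  have "\<exists>s\<in>S \<inter> set p. edge_inseparable (inside (insert s A) E) u s"
    if path: "is_path (E - ?F) u v p" and hit: "set p \<inter> S \<noteq> {}" for v p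
  proof -
    have "is_path (E - edge_cut (avoiding S E) A) u v p"
      using path by (rule is_path_mono) blast
    then obtain q s where s_hit: "s \<in> S \<inter> set p" and segment: "u \<in> set q" "s \<in> set q"
      "path_edges q \<subseteq> path_edges p" "\<Union>(path_edges q) \<subseteq> insert s A"
      using assms(2,3) hit by (rule initial_segment_within_side)
    have "path_edges q \<subseteq> E - ?F"
      using segment(3) path by (auto simp: is_path_def)
    then have "path_edges q \<subseteq> inside (insert s A) E - F s"
      using segment(4) s_hit by (auto simp: inside_def)
    then have "edge_inseparable (inside (insert s A) E) u s"
      using segment(1,2) by (rule blocking)
    then show ?thesis
      using s_hit by blast
  qed
  moreover have "finite ?F"
    using assms(1,4) finite_F by simp
  ultimately show ?thesis
    by blast
qed

lemma ex_splitting_path: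
  assumes "finitely_separated E u v" "edge_inseparable E u v"
  obtains p A s t where "is_path E u v p" "u \<in> A" "v \<in> - A"
    "s \<in> inner p" "edge_inseparable (inside (insert s A) E) u s"
    "t \<in> inner p" "edge_inseparable (inside (insert t (- A)) E) v t"
proof -
  obtain A S where separator: "finite S" "u \<in> A" "v \<notin> A" "u \<notin> S" "v \<notin> S"
    and finite_cut: "finite (edge_cut (avoiding S E) A)"
    using assms(1) by (rule finitely_separatedE)
  obtain F\<^sub>u where "finite F\<^sub>u" and hit_u: "\<And>p. is_path (E - F\<^sub>u) u v p \<Longrightarrow> set p \<inter> S \<noteq> {} \<Longrightarrow>
      \<exists>s\<in>S \<inter> set p. edge_inseparable (inside (insert s A) E) u s"
    using ex_finite_edges_forcing_inseparable_hit[OF separator(1,2,4) finite_cut] by meson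
  have "v \<in> - A" "finite (edge_cut (avoiding S E) (- A))"
    using separator(3) finite_cut by (simp_all add: edge_cut_Compl)
  then obtain F\<^sub>v where "finite F\<^sub>v" and hit_v: "\<And>p. is_path (E - F\<^sub>v) v u p \<Longrightarrow> set p \<inter> S \<noteq> {} \<Longrightarrow>
      \<exists>t\<in>S \<inter> set p. edge_inseparable (inside (insert t (- A)) E) v t"
    using ex_finite_edges_forcing_inseparable_hit[OF separator(1) _ separator(5)] by meson
  obtain p where path: "is_path (E - (edge_cut (avoiding S E) A \<union> F\<^sub>u \<union> F\<^sub>v)) u v p"
    using ex_path_if_edge_inseparable[OF assms(2)] finite_cut \<open>finite F\<^sub>u\<close> \<open>finite F\<^sub>v\<close>
    by (meson finite_UnI)
  then have set_p: "set p = {u, v} \<union> inner p"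
    using separator(2,3) by (intro set_is_path) auto
  have hit: "set p \<inter> S \<noteq> {}"
    using path set_p separator(2,3) path_edges_meet_separator[of p E S u v A]
    by (auto simp: is_path_def)
  have "is_path (E - F\<^sub>u) u v p" "is_path E u v p"
    using path by (auto elim: is_path_mono)
  moreover have "is_path (E - F\<^sub>v) v u (rev p)"
    using is_path_rev[OF path] by (rule is_path_mono) auto
  moreover have "S \<inter> set p \<subseteq> inner p"
    using set_p separator(4,5) by auto
  ultimately show thesis
    using hit_u[of p] hit_v[of "rev p"] hit separator(2,3) that[of p A] by auto
qed

lemma subdivided_pi_branch_vertices:
  assumes "subdivided_pi G B" "u \<in> B" "v \<in> B"
  shows "wf_graph G" "finitely_separable G" "edge_inseparable (edges G) u v" "u \<in> verts G"
proof -
  obtain \<Gamma> P where \<Gamma>: "verts \<Gamma> = B" "pi_graph \<Gamma>" and "subdivision G \<Gamma> P"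
    using assms(1) unfolding subdivided_pi_def by (metis subdivision_ofE)
  interpret subdivision G \<Gamma> P
    by fact
  show "wf_graph G"
    by (rule wf_G)
  show "finitely_separable G"
    using \<Gamma>(2) by (simp add: pi_graph_iff finitely_separable_iff)
  show "edge_inseparable (edges G) u v"
    using \<Gamma> assms(2,3)
    by (intro edge_inseparable_subdivision) (simp add: pi_graph_iff inf_edge_connected_iff)
  show "u \<in> verts G"
    using \<Gamma>(1) assms(2) verts_eq by blast
qed

theorem theorem6p1:
  fixes G :: "'a graph" and B :: "'a set" and u v :: 'a
  assumes "subdivided_pi G B" and "u \<in> B" and "v \<in> B" and "u \<noteq> v"
  shows "\<exists>Hu Hv. subgraph Hu G \<and> subgraph Hv G \<and>
     (let X = verts Hu \<inter> verts Hv in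
        X \<noteq> {} \<and>
        induced Hu X = induced Hv X \<and> finite X \<and> connected_graph (induced Hu X) \<and>
        u \<notin> X \<and> v \<notin> X \<and>
        (\<exists>Bu. subdivided_pi (contract Hu X) Bu \<and> {u} \<in> Bu \<and> X \<in> Bu) \<and>
        (\<exists>Bv. subdivided_pi (contract Hv X) Bv \<and> {v} \<in> Bv \<and> X \<in> Bv) \<and>
        {{u}, X} \<in> edges (contract Hu X) \<and> {{v}, X} \<in> edges (contract Hv X))"
proof -
  note branch = subdivided_pi_branch_vertices[OF assms(1-3)]
  have "v \<in> verts G"
    using assms(1,3) by (intro subdivided_pi_branch_vertices(4))
  then have "finitely_separated (edges G) u v"
    using branch(2,4) assms(4) by (simp add: finitely_separable_def)
  then obtain p A s t where path: "is_path (edges G) u v p" and "u \<in> A" "v \<in> - A"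
    and hit_u: "s \<in> inner p" "edge_inseparable (inside (insert s A) (edges G)) u s"
    and hit_v: "t \<in> inner p" "edge_inseparable (inside (insert t (- A)) (edges G)) v t"
    using branch(3) by (rule ex_splitting_path)
  obtain Hu where side_u: "pi_side G (inner p) u Hu" "verts Hu \<subseteq> A \<union> inner p"
    using branch(1,2) path assms(4) \<open>u \<in> A\<close> hit_u by (rule ex_pi_side_along_path)
  obtain Hv where side_v: "pi_side G (inner p) v Hv" "verts Hv \<subseteq> - A \<union> inner p"
    using branch(1,2) is_path_rev[OF path] assms(4)[symmetric] \<open>v \<in> - A\<close> hit_v
    by (rule ex_pi_side_along_path[where p = "rev p", unfolded inner_rev])
  have "verts Hu \<inter> verts Hv = inner p"
    using side_u side_v by (auto simp: pi_side_def)
  moreover have "u \<notin> inner p" "v \<notin> inner p" "connected_graph (induced G (inner p))"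
    using path ends_not_inner[of p] connected_graph_induced_inner
    by (auto simp: is_path_def ends_def)
  moreover have "finite (inner p)" "inner p \<noteq> {}"
    using hit_u(1) by (auto simp: inner_def)
  ultimately show ?thesis
    using side_u(1) side_v(1) unfolding pi_side_def
    by (intro exI[of _ Hu] exI[of _ Hv]) (simp add: Let_def)
qed

end
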